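(* Let $A:X\to Y$ be an injective bounded linear operator with non-closed range between Hilbert spaces. Let $\Psi(\lambda)$, $0<\lambda<\infty$, be a concave and strictly increasing index function satisfying $\lim_{\lambda\to+0}\Psi(\lambda)=0$, $\lim_{\lambda\to\infty}\Psi(\lambda)=\infty$ and $\lim_{\lambda\to\infty}\Psi(\lambda)/\lambda=0$. Let $T=(A^*A)^{-1}$ and set $\phi(\lambda):=\lambda$, $\theta(\lambda):=1/\lambda$ and $\psi(\lambda):=\Psi^{-1}(\lambda)$ for $0<\lambda<\infty$. Then $f\in X_{\psi\theta}$ if and only if $f$ satisfies a source condition $$f=\bar\psi(A^*A)v\quad\text{with some } v\in X,$$ with the function $$\bar\psi(t)=\frac{1}{\sqrt{t\,\Psi^{-1}(1/t)}},\qquad 0<t<\infty,$$ which is then a rate function.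
   Context: $X$ and $Y$ are infinite dimensional separable Hilbert spaces. An index function is a continuous function $(0,\infty)\to(0,\infty)$. A rate function is an index function $\bar\theta$ that is monotonically increasing (non-strictly) with $\lim_{t\to+0}\bar\theta(t)=0$. $\Psi^{-1}$ is the inverse function of $\Psi$; $\psi\theta$ is the pointwise product. For an index function $\nu$, the space $X_\nu$ of the variable Hilbert scale generated by $T$ is the closure (completion) of the domain of the quadratic form $\|h\|_\nu^2=(h,\nu(T)h)$, with norm $\|\cdot\|_\nu$; functions of $T$ and of $A^*A$ are defined by the spectral calculus. *)

theory Defs
  imports "HOL-Analysis.Analysis"
begin

section \<open>Index functions and rate functions\<close>

definition index_function :: "(real \<Rightarrow> real) \<Rightarrow> bool" where
  "index_function g \<longleftrightarrow> continuous_on {0<..} g \<and> (\<forall>t>0. 0 < g t)"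

definition rate_function :: "(real \<Rightarrow> real) \<Rightarrow> bool" where
  "rate_function g \<longleftrightarrow> index_function g \<and> mono_on {0<..} g \<and> (g \<longlongrightarrow> 0) (at_right 0)"


section \<open>Spectral calculus of a (possibly unbounded) self-adjoint operator\<close>

text \<open>An operator whose domain need not be the whole space is given by its graph. In particular
  the inverse of an injective operator is the converse of its graph.\<close>

type_synonym 'a operator = "('a \<times> 'a) set"

definition graph_of :: "('a \<Rightarrow> 'a) \<Rightarrow> 'a operator" where
  "graph_of B = {(x, B x) | x. True}"

definition infinite_dimensional :: "'a::real_vector itself \<Rightarrow> bool" where
  "infinite_dimensional _ \<longleftrightarrow> \<not> (\<exists>B::'a set. finite B \<and> span B = UNIV)"

definition orthogonal_projection :: "('a::real_inner \<Rightarrow> 'a) \<Rightarrow> bool" where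
  "orthogonal_projection P \<longleftrightarrow>
     bounded_linear P \<and> (\<forall>x. P (P x) = P x) \<and> (\<forall>x y. inner (P x) y = inner x (P y))"

text \<open>Projection-valued Borel measures on the real line, countably additive in the strong operator
  topology. Values on non-Borel sets are irrelevant.\<close>

definition projection_valued_measure :: "(real set \<Rightarrow> 'a::real_inner \<Rightarrow> 'a) \<Rightarrow> bool" where
  "projection_valued_measure E \<longleftrightarrow>
     (\<forall>M\<in>sets borel. orthogonal_projection (E M)) \<and>
     (\<forall>x. E UNIV x = x) \<and>
     (\<forall>M\<in>sets borel. \<forall>N\<in>sets borel. \<forall>x. E (M \<inter> N) x = E M (E N x)) \<and>
     (\<forall>M. range M \<subseteq> sets borel \<longrightarrow> disjoint_family M \<longrightarrow>
        (\<forall>x. (\<lambda>n::nat. E (M n) x) sums E (\<Union>n. M n) x))"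

definition scalar_measure :: "(real set \<Rightarrow> 'a::real_inner \<Rightarrow> 'a) \<Rightarrow> 'a \<Rightarrow> real measure" where
  "scalar_measure E x = measure_of UNIV (sets borel) (\<lambda>M. ennreal (inner (E M x) x))"

definition spectral_domain ::
    "(real set \<Rightarrow> 'a::real_inner \<Rightarrow> 'a) \<Rightarrow> (real \<Rightarrow> real) \<Rightarrow> 'a set" where
  "spectral_domain E g = {x. integrable (scalar_measure E x) (\<lambda>t. (g t)\<^sup>2)}"

text \<open>The graph of the operator \<open>\<integral> g dE\<close>, for Borel \<open>g\<close>. The integral of \<open>g\<close> against the signed
  measure \<open>M \<mapsto> (E M x, z)\<close> is written by polarization. It suffices to test with \<open>z\<close> in the
  domain, which is a dense subspace; this also makes both integrals finite.\<close>

definition spectral_integral ::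
    "(real set \<Rightarrow> 'a::real_inner \<Rightarrow> 'a) \<Rightarrow> (real \<Rightarrow> real) \<Rightarrow> 'a operator" where
  "spectral_integral E g =
     {(x, y). x \<in> spectral_domain E g \<and>
        (\<forall>z\<in>spectral_domain E g.
           inner y z = ((\<integral>t. g t \<partial>scalar_measure E (x + z)) - (\<integral>t. g t \<partial>scalar_measure E (x - z))) / 4)}"

definition spectral_measure_of :: "'a::real_inner operator \<Rightarrow> (real set \<Rightarrow> 'a \<Rightarrow> 'a) \<Rightarrow> bool" where
  "spectral_measure_of S E \<longleftrightarrow>
     projection_valued_measure E \<and> S = spectral_integral E (\<lambda>t. t)"

text \<open>The operator \<open>g(S)\<close>. By the spectral theorem a self-adjoint \<open>S\<close> on a Hilbert space has a
  spectral measure \<open>E\<close>, unique on Borel sets, so that the existential quantifier below just names it.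
  The function \<open>g\<close> is given on \<open>(0, \<infinity>)\<close> only and is extended by zero; this convention is
  immaterial for the positive injective operators considered here, since then
  \<open>E {..0} = 0\<close>.\<close>

definition fun_of_op :: "(real \<Rightarrow> real) \<Rightarrow> 'a::real_inner operator \<Rightarrow> 'a operator" where
  "fun_of_op g S =
     {(x, y). \<exists>E. spectral_measure_of S E \<and>
        (x, y) \<in> spectral_integral E (\<lambda>t. if 0 < t then g t else 0)}"


section \<open>Variable Hilbert scales\<close>

definition op_apply :: "'a operator \<Rightarrow> 'a \<Rightarrow> 'a" where
  "op_apply S x = (THE y. (x, y) \<in> S)"

definition scale_norm :: "'a::real_inner operator \<Rightarrow> (real \<Rightarrow> real) \<Rightarrow> 'a \<Rightarrow> real" where
  "scale_norm T \<nu> h = sqrt (inner h (op_apply (fun_of_op \<nu> T) h))"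

text \<open>The vectors \<open>h\<close> for which \<open>(h, \<nu>(T) h)\<close> makes sense are those in the domain of \<open>\<nu>(T)\<close>.\<close>

definition scale_Cauchy :: "'a::real_inner operator \<Rightarrow> (real \<Rightarrow> real) \<Rightarrow> (nat \<Rightarrow> 'a) set" where
  "scale_Cauchy T \<nu> =
     {h. (\<forall>n. h n \<in> Domain (fun_of_op \<nu> T)) \<and>
         (\<forall>e>0. \<exists>N. \<forall>m\<ge>N. \<forall>n\<ge>N. scale_norm T \<nu> (h m - h n) < e)}"

definition scale_equiv ::
    "'a::real_inner operator \<Rightarrow> (real \<Rightarrow> real) \<Rightarrow> ((nat \<Rightarrow> 'a) \<times> (nat \<Rightarrow> 'a)) set" where
  "scale_equiv T \<nu> =
     {(h, k). h \<in> scale_Cauchy T \<nu> \<and> k \<in> scale_Cauchy T \<nu> \<and>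
        (\<lambda>n. scale_norm T \<nu> (h n - k n)) \<longlonglongrightarrow> 0}"

text \<open>\<open>X\<^sub>\<nu>\<close>: the completion of this domain under the norm \<open>scale_norm T \<nu>\<close>, as the set of
  equivalence classes of Cauchy sequences.\<close>

definition scale_space :: "'a::real_inner operator \<Rightarrow> (real \<Rightarrow> real) \<Rightarrow> (nat \<Rightarrow> 'a) set set" where
  "scale_space T \<nu> = scale_Cauchy T \<nu> // scale_equiv T \<nu>"

text \<open>An element \<open>F\<close> of the completion is identified with the vector \<open>f\<close> of \<open>X\<close> if some sequence
  in the class \<open>F\<close> converges to \<open>f\<close> in \<open>X\<close>. As the quadratic form of the positive
  self-adjoint operator \<open>\<nu>(T)\<close> is closable, this is independent of choices. An element of the
  completion need not be identified with any vector of \<open>X\<close> for general \<open>\<nu>\<close>.\<close>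

definition represents :: "(nat \<Rightarrow> 'a::topological_space) set \<Rightarrow> 'a \<Rightarrow> bool" where
  "represents F f \<longleftrightarrow> (\<exists>h\<in>F. h \<longlonglongrightarrow> f)"

definition in_scale_space :: "'a::real_inner \<Rightarrow> 'a operator \<Rightarrow> (real \<Rightarrow> real) \<Rightarrow> bool" where
  "in_scale_space f T \<nu> \<longleftrightarrow> (\<exists>F\<in>scale_space T \<nu>. represents F f)"

end

theory Submission
  imports Defs
begin

text \<open>Everything takes place in the spectral measure \<open>E\<close> of \<open>T\<close>, whose image under \<open>t \<mapsto> 1 / t\<close> is the
  spectral measure of \<open>A\<^sup>* A\<close>. Put \<open>\<nu> = \<psi> \<theta>\<close>. Since \<open>\<psi>bar t = 1 / sqrt (\<nu> (1 / t))\<close>, the operator \<open>\<psi>bar(A\<^sup>* A)\<close>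
  is \<open>\<nu>(T)\<close> to the power \<open>-1/2\<close>, and its range is the domain of \<open>\<nu>(T)\<close> to the power \<open>1/2\<close>. This domain is the
  form domain of \<open>\<nu>(T)\<close>, that is \<open>X\<^sub>\<nu>\<close>: the cut-offs \<open>E {t. \<nu> t \<le> n} f\<close> approximate \<open>f\<close> in the form norm, and
  this norm dominates the norm of \<open>X\<close> because \<open>T\<close> is bounded below by a positive constant and \<open>\<nu>\<close> is
  monotone. That \<open>\<nu>\<close> is monotone means that \<open>\<Psi> l / l\<close> is decreasing, which follows from
  concavity and \<open>\<Psi>(0+) = 0\<close>.

  The existence half of the spectral theorem is not needed: \<open>T\<close> has a spectral measure if and only if
  \<open>A\<^sup>* A\<close> has one, and without them both sides of the equivalence are empty. Uniqueness is needed, and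
  follows from the moments of the measures \<open>(E M x, x)\<close>, which have compact support for \<open>A\<^sup>* A\<close>.\<close>

section \<open>The Riesz representation theorem and adjoints\<close>

text \<open>The representing vector minimizes \<open>\<lambda>x. \<parallel>x\<parallel>\<^sup>2 - 2 f x\<close>; minimizing sequences are Cauchy by
  the parallelogram law.\<close>

lemma riesz_representation:
  fixes f :: "'a::{real_inner, complete_space} \<Rightarrow> real"
  assumes "bounded_linear f"
  shows "\<exists>u. \<forall>x. f x = inner u x"
proof -
  interpret f: bounded_linear f by fact
  obtain K where K: "\<And>x. norm (f x) \<le> norm x * K" "K > 0" using f.pos_bounded by blast
  define F where "F = (\<lambda>x. (norm x)\<^sup>2 - 2 * f x)"
  have low: "F x \<ge> - K\<^sup>2" for x
  proof -
    have "f x \<le> norm x * K" using K(1)[of x] by simp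
    moreover have "0 \<le> (norm x - K)\<^sup>2" by simp
    ultimately show ?thesis unfolding F_def by (simp add: power2_eq_square algebra_simps)
  qed
  define m where "m = Inf (range F)"
  have bdd: "bdd_below (range F)" using low by (auto simp: bdd_below_def)
  have mle: "m \<le> F x" for x unfolding m_def by (rule cINF_lower[OF bdd]) simp
  have "\<exists>x. F x < m + 1 / Suc n" for n
  proof -
    have "m < m + 1 / Suc n" by simp
    then show ?thesis unfolding m_def using cINF_less_iff[OF _ bdd] by blast
  qed
  then obtain X where X: "\<And>n. F (X n) < m + 1 / Suc n" by metis
  \<comment> \<open>The midpoint of \<open>x\<close> and \<open>y\<close> also has
    \<open>F\<close>-value at least \<open>m\<close>, so two near-minimizers must be close to each
    other.\<close>
  have par: "(norm (x - y))\<^sup>2 \<le> 2 * (F x - m) + 2 * (F y - m)" for x y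
  proof -
    have "f ((1/2) *\<^sub>R (x + y)) = (f x + f y) / 2"
      by (simp add: f.scale f.add del: scaleR_add_right)
    then have "4 * F ((1/2) *\<^sub>R (x + y)) = (norm (x + y))\<^sup>2 - 4 * f x - 4 * f y"
      unfolding F_def norm_scaleR by (simp add: power_divide power_mult_distrib del: scaleR_add_right)
    moreover have "(norm (x + y))\<^sup>2 + (norm (x - y))\<^sup>2 = 2 * (norm x)\<^sup>2 + 2 * (norm y)\<^sup>2"
      by (simp add: power2_norm_eq_inner algebra_simps inner_commute)
    ultimately show ?thesis using mle[of "(1/2) *\<^sub>R (x + y)"] unfolding F_def by simp
  qed
  have "Cauchy X"
  proof (rule CauchyI)
    fix e :: real assume "e > 0"
    then obtain N where N: "inverse (real (Suc N)) < e\<^sup>2 / 4"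
      using reals_Archimedean[of "e\<^sup>2/4"] by auto
    show "\<exists>N. \<forall>m\<ge>N. \<forall>n\<ge>N. norm (X m - X n) < e"
    proof (intro exI allI impI)
      fix i j assume ij: "i \<ge> N" "j \<ge> N"
      have *: "F (X k) - m < e\<^sup>2/4" if "k \<ge> N" for k
      proof -
        have "inverse (real (Suc k)) \<le> inverse (real (Suc N))" using that by (simp add: field_simps)
        then show ?thesis using X[of k] N by (simp add: inverse_eq_divide)
      qed
      have "(norm (X i - X j))\<^sup>2 \<le> 2 * (F (X i) - m) + 2 * (F (X j) - m)" by (rule par)
      also have "\<dots> < 2 * (e\<^sup>2/4) + 2 * (e\<^sup>2/4)"
        using *[OF ij(1)] *[OF ij(2)] by (intro add_strict_mono mult_strict_left_mono) auto
      finally have "(norm (X i - X j))\<^sup>2 < e\<^sup>2" by simp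
      then show "norm (X i - X j) < e" using \<open>e > 0\<close> by (simp add: power2_less_imp_less)
    qed
  qed
  then obtain u where u: "X \<longlonglongrightarrow> u" using Cauchy_convergent_iff convergent_def by blast
  have "(\<lambda>n. F (X n)) \<longlonglongrightarrow> F u" unfolding F_def by (intro tendsto_intros u f.tendsto)
  moreover have "(\<lambda>n. m + 1 / Suc n) \<longlonglongrightarrow> m + 0"
    by (intro tendsto_intros LIMSEQ_Suc[OF lim_1_over_n])
  ultimately have Fu: "F u \<le> m"
    using LIMSEQ_le[of "\<lambda>n. F (X n)" "F u" "\<lambda>n. m + 1 / Suc n" "m + 0"] X less_imp_le by auto
  have "f y = inner u y" for y
  proof (rule ccontr)
    assume ne: "f y \<noteq> inner u y"
    define d where "d = f y - inner u y"
    have y0: "y \<noteq> 0" using ne f.zero by auto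
    \<comment> \<open>This \<open>t\<close> minimizes the quadratic polynomial
      \<open>t \<mapsto> F (u + t *\<^sub>R y)\<close>, whose linear coefficient is
      \<open>- 2 * d\<close>. Its minimum lies below \<open>F u\<close> unless
      \<open>d = 0\<close>.\<close>
    define t where "t = d / (norm y)\<^sup>2"
    have "F (u + t *\<^sub>R y) = F u - 2 * t * d + t\<^sup>2 * (norm y)\<^sup>2"
      unfolding F_def d_def power2_norm_eq_inner
      by (simp add: f.add f.scale algebra_simps inner_commute power2_eq_square)
    also have "\<dots> = F u - d\<^sup>2 / (norm y)\<^sup>2"
      unfolding t_def using y0 by (simp add: field_simps power2_eq_square)
    also have "\<dots> < F u" using y0 ne unfolding d_def by simp
    finally show False using mle[of "u + t *\<^sub>R y"] Fu by simp
  qed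
  then show ?thesis by blast
qed

text \<open>\<open>adjoint\<close> is a choice of some function with this property. The Riesz
  theorem, applied to \<open>\<lambda>x. inner (A x) y\<close> for each \<open>y\<close>, provides a
  witness for the choice.\<close>

lemma inner_adjoint:
  fixes A :: "'a::{real_inner, complete_space} \<Rightarrow> 'b::real_inner"
  assumes "bounded_linear A"
  shows "inner (A x) y = inner x (adjoint A y)"
proof -
  have "\<exists>u. \<forall>x. inner (A x) y = inner u x" for y
  proof -
    have "bounded_linear (\<lambda>x. inner (A x) y)"
      using bounded_linear_compose[OF bounded_linear_inner_left assms] .
    then show ?thesis by (rule riesz_representation)
  qed
  then obtain g where "\<And>x y. inner (A x) y = inner x (g y)" by (metis inner_commute)
  then show ?thesis
    unfolding adjoint_def
    using someI_ex[of "\<lambda>f'. \<forall>x y. inner (A x) y = inner x (f' y)"] by blast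
qed

section \<open>Projection-valued measures\<close>

text \<open>A symmetric operator is determined by its quadratic form. The right-hand side has the
  shape in which \<open>spectral_integral\<close> writes an integral against
  \<open>(E M x, z)\<close>.\<close>

lemma polarization:
  assumes "linear P" and "\<And>x z. inner (P x) z = inner x (P z)"
  shows "inner (P x) z = (inner (P (x + z)) (x + z) - inner (P (x - z)) (x - z)) / 4"
proof -
  have "inner (P z) x = inner (P x) z" by (metis assms(2) inner_commute)
  then show ?thesis
    by (simp add: linear_add[OF assms(1)] linear_diff[OF assms(1)] inner_add_left inner_add_right
        inner_diff_left inner_diff_right)
qed

locale pvm =
  fixes E :: "real set \<Rightarrow> 'a::{real_inner, complete_space} \<Rightarrow> 'a"
  assumes pvm: "projection_valued_measure E"
begin

abbreviation mu :: "'a \<Rightarrow> real measure" where "mu x \<equiv> scalar_measure E x"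

lemma proj_bounded_linear: "M \<in> sets borel \<Longrightarrow> bounded_linear (E M)"
  and proj_symmetric: "M \<in> sets borel \<Longrightarrow> inner (E M x) z = inner x (E M z)"
  and proj_UNIV [simp]: "E UNIV x = x"
  and proj_Int: "M \<in> sets borel \<Longrightarrow> N \<in> sets borel \<Longrightarrow> E M (E N x) = E (M \<inter> N) x"
  using pvm unfolding projection_valued_measure_def orthogonal_projection_def by auto

lemma proj_sums:
  "range M \<subseteq> sets borel \<Longrightarrow> disjoint_family M \<Longrightarrow> (\<lambda>n::nat. E (M n) x) sums E (\<Union>n. M n) x"
  using pvm unfolding projection_valued_measure_def by blast

lemma proj_quadratic: "M \<in> sets borel \<Longrightarrow> inner (E M x) x = (norm (E M x))\<^sup>2"
  by (metis Int_absorb proj_Int proj_symmetric power2_norm_eq_inner inner_commute)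

text \<open>Countable additivity for the constant family \<open>{}\<close> gives a convergent series
  with constant terms.\<close>

lemma proj_empty [simp]: "E {} x = 0"
proof -
  have "(\<lambda>n::nat. E {} x) sums E (\<Union>n::nat. {}) x"
    using proj_sums[of "\<lambda>n. {}" x] by (simp add: disjoint_family_on_def)
  then have "(\<lambda>n::nat. E {} x) \<longlonglongrightarrow> 0" using sums_summable summable_LIMSEQ_zero by blast
  then show ?thesis by (simp add: LIMSEQ_const_iff)
qed

lemma space_mu [simp]: "space (mu x) = UNIV"
  and sets_mu [simp, measurable_cong]: "sets (mu x) = sets borel"
proof -
  show "space (mu x) = UNIV" unfolding scalar_measure_def by (simp add: space_measure_of)
  have "sets borel = sigma_sets UNIV (sets (borel :: real measure))"
    using sets.sigma_sets_eq[of "borel :: real measure"] by (metis space_borel)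
  then show "sets (mu x) = sets borel"
    unfolding scalar_measure_def by (simp add: sets_measure_of)
qed

lemma measurable_mu [simp]: "borel_measurable (mu x) = borel_measurable borel"
  by (rule measurable_cong_sets) simp_all

lemma emeasure_mu:
  assumes "M \<in> sets borel"
  shows "emeasure (mu x) M = ennreal ((norm (E M x))\<^sup>2)"
proof -
  let ?m = "\<lambda>M. ennreal (inner (E M x) x)"
  have "emeasure (mu x) M = ?m M"
    unfolding scalar_measure_def
  proof (rule emeasure_measure_of[OF refl])
    show "M \<in> sets (measure_of UNIV (sets borel) ?m)"
      using assms sets_mu[of x] unfolding scalar_measure_def by simp
    have sm: "sets (measure_of UNIV (sets borel) ?m) = sets borel"
      using sets_mu[of x] unfolding scalar_measure_def by simp
    show "positive (sets (measure_of UNIV (sets borel) ?m)) ?m" by (simp add: positive_def)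
    show "countably_additive (sets (measure_of UNIV (sets borel) ?m)) ?m"
      unfolding sm
    proof (rule countably_additiveI)
      fix A :: "nat \<Rightarrow> real set"
      assume A: "range A \<subseteq> sets borel" "disjoint_family A" "(\<Union>i. A i) \<in> sets borel"
      have "(\<lambda>n. inner (E (A n) x) x) sums inner (E (\<Union>n. A n) x) x"
        using bounded_linear.sums[OF bounded_linear_inner_left proj_sums[OF A(1,2)]] .
      moreover have "0 \<le> inner (E (A n) x) x" for n
      proof -
        have "A n \<in> sets borel" using A(1) by blast
        then show ?thesis by (simp add: proj_quadratic)
      qed
      ultimately show "(\<Sum>i. ?m (A i)) = ?m (\<Union>i. A i)"
        by (subst suminf_ennreal2) (auto simp: sums_iff)
    qed
  qed simp
  then show ?thesis using proj_quadratic[OF assms] by simp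
qed

lemma finite_measure_mu: "finite_measure (mu x)"
  by (rule finite_measureI) (simp add: emeasure_mu)

lemma measure_mu: "M \<in> sets borel \<Longrightarrow> measure (mu x) M = (norm (E M x))\<^sup>2"
  by (simp add: measure_def emeasure_mu)

text \<open>Since \<open>E N (E M x) = E (M \<inter> N) x\<close>, projecting a vector by
  \<open>E M\<close> cuts its scalar measure down to \<open>M\<close>. This is how integrals over
  \<open>M\<close> are realized by vectors.\<close>

lemma mu_proj:
  assumes M: "M \<in> sets borel"
  shows "mu (E M x) = density (mu x) (indicator M)"
proof (rule measure_eqI)
  fix N assume "N \<in> sets (mu (E M x))"
  then have N: "N \<in> sets borel" by simp
  have "emeasure (density (mu x) (indicator M)) N = (\<integral>\<^sup>+t. indicator M t * indicator N t \<partial>mu x)"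
    using M N by (subst emeasure_density) auto
  also have "\<dots> = (\<integral>\<^sup>+t. indicator (M \<inter> N) t \<partial>mu x)"
    by (rule nn_integral_cong) (auto split: split_indicator)
  also have "\<dots> = emeasure (mu x) (M \<inter> N)" using M N by simp
  finally show "emeasure (mu (E M x)) N = emeasure (density (mu x) (indicator M)) N"
    using M N by (simp add: emeasure_mu proj_Int Int_commute)
qed simp

text \<open>For an indicator this is the parallelogram law for the vectors \<open>E A x\<close> and
  \<open>E A z\<close>; both sides respect sums, multiples and increasing limits. The integrals may
  be infinite, so the identity can itself be used to prove finiteness.\<close>

lemma parallelogram_mu:
  assumes "f \<in> borel_measurable borel"
  shows "(\<integral>\<^sup>+t. f t \<partial>mu (x + z)) + (\<integral>\<^sup>+t. f t \<partial>mu (x - z))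
    = 2 * (\<integral>\<^sup>+t. f t \<partial>mu x) + 2 * (\<integral>\<^sup>+t. f t \<partial>mu z)"
  using assms
proof (induction rule: borel_measurable_induct)
  case (cong f g)
  then show ?case by (simp add: fun_eq_iff)
next
  case (set A)
  interpret bounded_linear "E A" using set by (intro proj_bounded_linear) simp
  have "(norm (E A (x + z)))\<^sup>2 + (norm (E A (x - z)))\<^sup>2 = 2 * (norm (E A x))\<^sup>2 + 2 * (norm (E A z))\<^sup>2"
    by (simp add: add diff power2_norm_eq_inner inner_add_left inner_add_right inner_diff_left
        inner_diff_right inner_commute)
  then have "ennreal ((norm (E A (x + z)))\<^sup>2 + (norm (E A (x - z)))\<^sup>2)
    = ennreal (2 * (norm (E A x))\<^sup>2 + 2 * (norm (E A z))\<^sup>2)" by simp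
  then show ?case using set by (simp add: emeasure_mu ennreal_plus ennreal_mult)
next
  case (mult u c)
  then have "(\<integral>\<^sup>+t. c * u t \<partial>mu y) = c * (\<integral>\<^sup>+t. u t \<partial>mu y)" for y
    by (simp add: nn_integral_cmult)
  then show ?case
    using arg_cong[OF mult.IH, of "(*) c"] by (simp add: distrib_left mult.left_commute)
next
  case (add u v)
  then have "(\<integral>\<^sup>+t. v t + u t \<partial>mu y) = (\<integral>\<^sup>+t. v t \<partial>mu y) + (\<integral>\<^sup>+t. u t \<partial>mu y)" for y
    by (simp add: nn_integral_add)
  then show ?case
    using arg_cong2[OF add.IH, of "(+)"] by (simp add: distrib_left ac_simps)
next
  case (seq U)
  have lim: "(\<lambda>i. \<integral>\<^sup>+t. U i t \<partial>mu y) \<longlonglongrightarrow> (\<integral>\<^sup>+t. Sup (range U) t \<partial>mu y)" for y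
  proof -
    have "incseq (\<lambda>i. \<integral>\<^sup>+t. U i t \<partial>mu y)"
      using seq by (auto simp: incseq_def le_fun_def intro!: nn_integral_mono)
    from LIMSEQ_SUP[OF this] show ?thesis
      using nn_integral_monotone_convergence_SUP[of U "mu y"] seq by (simp add: image_comp)
  qed
  have "(\<lambda>i. (\<integral>\<^sup>+t. U i t \<partial>mu (x + z)) + (\<integral>\<^sup>+t. U i t \<partial>mu (x - z)))
      \<longlonglongrightarrow> (\<integral>\<^sup>+t. Sup (range U) t \<partial>mu (x + z)) + (\<integral>\<^sup>+t. Sup (range U) t \<partial>mu (x - z))"
    by (intro tendsto_add lim)
  moreover have "(\<lambda>i. 2 * (\<integral>\<^sup>+t. U i t \<partial>mu x) + 2 * (\<integral>\<^sup>+t. U i t \<partial>mu z))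
      \<longlonglongrightarrow> 2 * (\<integral>\<^sup>+t. Sup (range U) t \<partial>mu x) + 2 * (\<integral>\<^sup>+t. Sup (range U) t \<partial>mu z)"
    by (intro tendsto_add ennreal_tendsto_cmult lim) auto
  ultimately show ?case using seq.IH LIMSEQ_unique by auto
qed

section \<open>Functional calculus for simple functions\<close>

definition simple_calc :: "(real \<Rightarrow> real) \<Rightarrow> 'a \<Rightarrow> 'a" where
  "simple_calc s x = (\<Sum>c\<in>range s. c *\<^sub>R E (s -` {c}) x)"

lemma simple_borel:
  assumes "simple_function borel (s :: real \<Rightarrow> real)"
  shows "finite (range s)" "s -` {c} \<in> sets borel" "s \<in> borel_measurable borel"
proof -
  show "finite (range s)" using assms by (simp add: simple_function_def)
  show meas: "s \<in> borel_measurable borel" using assms by (rule borel_measurable_simple_function)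
  show "s -` {c} \<in> sets borel" using measurable_sets[OF meas, of "{c}"] by simp
qed

lemma simple_eq_sum_indicator:
  assumes "simple_function borel (s :: real \<Rightarrow> real)"
  shows "s t = (\<Sum>c\<in>range s. c * indicator (s -` {c}) t)"
proof -
  have "(\<Sum>c\<in>range s. c * indicator (s -` {c}) t) = (\<Sum>c\<in>range s. if c = s t then c else 0)"
    by (rule sum.cong) (auto simp: indicator_def)
  also have "\<dots> = s t" using simple_borel(1)[OF assms] by (subst sum.delta) auto
  finally show ?thesis by simp
qed

lemma integrable_simple:
  assumes "simple_function borel (s :: real \<Rightarrow> real)"
  shows "integrable (mu x) s"
proof -
  interpret finite_measure "mu x" by (rule finite_measure_mu)
  have "norm (s t) \<le> Max ((\<lambda>c. norm c) ` range s)" for t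
    using simple_borel(1)[OF assms] by (intro Max_ge) auto
  then show ?thesis using simple_borel(3)[OF assms]
    by (intro integrable_const_bound[of _ "Max ((\<lambda>c. norm c) ` range s)"]) auto
qed

lemma integrable_sum_indicator:
  assumes "\<And>i. i \<in> I \<Longrightarrow> N i \<in> sets borel"
  shows "integrable (mu x) (\<lambda>t. \<Sum>i\<in>I. c i * indicator (N i) t :: real)"
proof -
  interpret finite_measure "mu x" by (rule finite_measure_mu)
  show ?thesis using assms
    by (intro Bochner_Integration.integrable_sum integrable_mult_right integrable_real_indicator)
      (auto simp: emeasure_mu)
qed

lemma integral_sum_indicator:
  assumes N: "\<And>i. i \<in> I \<Longrightarrow> N i \<in> sets borel"
  shows "(\<integral>t. (\<Sum>i\<in>I. c i * indicator (N i) t :: real) \<partial>mu x) = (\<Sum>i\<in>I. c i * inner (E (N i) x) x)"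
proof -
  have "(\<integral>t. (\<Sum>i\<in>I. c i * indicator (N i) t :: real) \<partial>mu x)
    = (\<Sum>i\<in>I. \<integral>t. c i * indicator (N i) t \<partial>mu x)"
  proof (rule Bochner_Integration.integral_sum)
    fix i assume "i \<in> I"
    then show "integrable (mu x) (\<lambda>t. c i * indicator (N i) t)"
      using N by (intro integrable_mult_right integrable_real_indicator)
        (auto simp: emeasure_mu)
  qed
  also have "\<dots> = (\<Sum>i\<in>I. c i * inner (E (N i) x) x)"
    using N by (intro sum.cong refl) (simp add: measure_mu proj_quadratic)
  finally show ?thesis .
qed

lemma linear_proj: "M \<in> sets borel \<Longrightarrow> linear (E M)"
  using proj_bounded_linear bounded_linear.linear by blast

lemma proj_sum_scaleR:
  assumes M: "M \<in> sets borel" and N: "\<And>i. i \<in> I \<Longrightarrow> N i \<in> sets borel"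
  shows "E M (\<Sum>i\<in>I. c i *\<^sub>R E (N i) x) = (\<Sum>i\<in>I. c i *\<^sub>R E (M \<inter> N i) x)"
proof -
  have "E M (\<Sum>i\<in>I. c i *\<^sub>R E (N i) x) = (\<Sum>i\<in>I. E M (c i *\<^sub>R E (N i) x))"
    by (rule linear_sum[OF linear_proj[OF M]])
  also have "\<dots> = (\<Sum>i\<in>I. c i *\<^sub>R E (M \<inter> N i) x)"
  proof (rule sum.cong[OF refl])
    fix i assume "i \<in> I"
    then show "E M (c i *\<^sub>R E (N i) x) = c i *\<^sub>R E (M \<inter> N i) x"
      using linear_cmul[OF linear_proj[OF M]] proj_Int[OF M N] by metis
  qed
  finally show ?thesis .
qed

lemma linear_simple_calc:
  assumes "simple_function borel s"
  shows "linear (simple_calc s)"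
  unfolding simple_calc_def
  by (intro linear_compose_sum ballI linear_compose_scale_right linear_proj simple_borel(2) assms)

lemma inner_simple_calc:
  "inner (simple_calc s x) z = (\<Sum>c\<in>range s. c * inner (E (s -` {c}) x) z)"
  by (simp add: simple_calc_def inner_sum_left)

lemma proj_symmetric': "M \<in> sets borel \<Longrightarrow> inner (E M x) z = inner (E M z) x"
  by (metis proj_symmetric inner_commute)

lemma symmetric_simple_calc:
  assumes "simple_function borel s"
  shows "inner (simple_calc s x) z = inner x (simple_calc s z)"
proof -
  have "inner (simple_calc s x) z = (\<Sum>c\<in>range s. c * inner (E (s -` {c}) z) x)"
    unfolding inner_simple_calc
    by (intro sum.cong refl) (simp add: proj_symmetric'[of _ x z] simple_borel(2)[OF assms])
  then show ?thesis by (metis inner_simple_calc inner_commute)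
qed

lemma simple_calc_quadratic:
  assumes "simple_function borel s"
  shows "inner (simple_calc s x) x = (\<integral>t. s t \<partial>mu x)"
proof -
  have "(\<integral>t. s t \<partial>mu x) = (\<integral>t. (\<Sum>c\<in>range s. c * indicator (s -` {c}) t) \<partial>mu x)"
    by (intro Bochner_Integration.integral_cong refl simple_eq_sum_indicator assms)
  then show ?thesis
    using simple_borel(2)[OF assms] by (simp add: integral_sum_indicator inner_simple_calc)
qed

text \<open>By polarization it suffices to compare quadratic forms, and that of
  \<open>simple_calc s\<close> is an integral over \<open>mu x\<close>. Algebraic identities for the
  calculus thus become identities between integrals.\<close>

lemma simple_calc_eqI:
  assumes s: "simple_function borel s"
    and P: "linear P" "\<And>x z. inner (P x) z = inner x (P z)"
    and q: "\<And>x. inner (P x) x = (\<integral>t. s t \<partial>mu x)"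
  shows "simple_calc s x = P x"
proof -
  have "inner (simple_calc s x) z = inner (P x) z" for z
    using polarization[OF P, of x z]
      polarization[OF linear_simple_calc[OF s] symmetric_simple_calc[OF s], of x z]
    by (simp only: q simple_calc_quadratic[OF s])
  then show ?thesis by (metis vector_eq_rdot)
qed

lemma simple_calc_diff:
  assumes s: "simple_function borel s" and r: "simple_function borel r"
  shows "simple_calc (\<lambda>t. s t - r t) x = simple_calc s x - simple_calc r x"
proof (rule simple_calc_eqI)
  show "simple_function borel (\<lambda>t. s t - r t)" using s r by (rule simple_function_diff)
  show "linear (\<lambda>x. simple_calc s x - simple_calc r x)"
    using s r by (intro linear_compose_sub linear_simple_calc)
  show "inner (simple_calc s x - simple_calc r x) z = inner x (simple_calc s z - simple_calc r z)" for x z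
    using s r by (simp add: inner_diff_left inner_diff_right symmetric_simple_calc)
  show "inner (simple_calc s x - simple_calc r x) x = (\<integral>t. s t - r t \<partial>mu x)" for x
    using s r by (simp add: inner_diff_left simple_calc_quadratic integrable_simple)
qed

lemma proj_simple_calc:
  assumes M: "M \<in> sets borel" and s: "simple_function borel s"
  shows "E M (simple_calc s x) = simple_calc s (E M x)"
proof -
  have "E M (simple_calc s x) = (\<Sum>c\<in>range s. c *\<^sub>R E (M \<inter> s -` {c}) x)"
    unfolding simple_calc_def by (intro proj_sum_scaleR M simple_borel(2)[OF s])
  also have "\<dots> = simple_calc s (E M x)"
    unfolding simple_calc_def
    by (intro sum.cong refl) (simp only: proj_Int[OF simple_borel(2)[OF s] M] Int_commute)
  finally show ?thesis .
qed

lemma inner_simple_calc_simple_calc: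
  assumes s: "simple_function borel s" and r: "simple_function borel r"
  shows "inner (simple_calc s (simple_calc r x)) z
    = (\<Sum>c\<in>range s. \<Sum>d\<in>range r. c * d * inner (E (s -` {c} \<inter> r -` {d}) x) z)"
  unfolding inner_simple_calc
proof (rule sum.cong[OF refl])
  fix c
  note M = simple_borel(2)[OF s, of c]
  have "E (s -` {c}) (simple_calc r x) = (\<Sum>d\<in>range r. d *\<^sub>R E (s -` {c} \<inter> r -` {d}) x)"
    unfolding simple_calc_def
    by (intro proj_sum_scaleR M simple_borel(2)[OF r])
  then show "c * inner (E (s -` {c}) (simple_calc r x)) z
    = (\<Sum>d\<in>range r. c * d * inner (E (s -` {c} \<inter> r -` {d}) x) z)"
    by (simp add: inner_sum_left sum_distrib_left mult.assoc)
qed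

text \<open>The composition expands into a double sum over the intersections of a level set of
  \<open>s\<close> with one of \<open>r\<close>. This expansion makes its symmetry visible and
  agrees with the expansion of \<open>s t * r t\<close> in indicators, so
  \<open>simple_calc_eqI\<close> applies.\<close>

lemma simple_calc_mult:
  assumes s: "simple_function borel s" and r: "simple_function borel r"
  shows "simple_calc (\<lambda>t. s t * r t) x = simple_calc s (simple_calc r x)"
proof (rule simple_calc_eqI)
  note bs = simple_borel[OF s] and br = simple_borel[OF r]
  show "simple_function borel (\<lambda>t. s t * r t)" using s r by (rule simple_function_mult)
  show "linear (\<lambda>x. simple_calc s (simple_calc r x))"
    using linear_compose[OF linear_simple_calc[OF r] linear_simple_calc[OF s]] by (simp add: o_def)
  show "inner (simple_calc s (simple_calc r x)) z = inner x (simple_calc s (simple_calc r z))" for x z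
  proof -
    have "inner x (simple_calc s (simple_calc r z)) = inner (simple_calc s (simple_calc r z)) x"
      by (rule inner_commute)
    also have "\<dots> = inner (simple_calc s (simple_calc r x)) z"
      unfolding inner_simple_calc_simple_calc[OF s r]
      by (intro sum.cong refl arg_cong2[where f = "(*)"] proj_symmetric' sets.Int bs br)
    finally show ?thesis by simp
  qed
  show "inner (simple_calc s (simple_calc r x)) x = (\<integral>t. s t * r t \<partial>mu x)" for x
  proof -
    have "(\<integral>t. s t * r t \<partial>mu x)
      = (\<integral>t. (\<Sum>c\<in>range s. \<Sum>d\<in>range r. (c * d) * indicator (s -` {c} \<inter> r -` {d}) t) \<partial>mu x)"
    proof (rule Bochner_Integration.integral_cong[OF refl])
      fix t
      show "s t * r t = (\<Sum>c\<in>range s. \<Sum>d\<in>range r. (c * d) * indicator (s -` {c} \<inter> r -` {d}) t)"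
        unfolding arg_cong2[OF simple_eq_sum_indicator[OF s] simple_eq_sum_indicator[OF r], of "(*)" t t]
          sum_product
        by (intro sum.cong refl) (simp add: indicator_inter_arith)
    qed
    also have "\<dots> = (\<Sum>c\<in>range s. \<integral>t. (\<Sum>d\<in>range r. (c * d) * indicator (s -` {c} \<inter> r -` {d}) t) \<partial>mu x)"
      using bs(2) br(2) by (intro Bochner_Integration.integral_sum integrable_sum_indicator) auto
    also have "\<dots> = inner (simple_calc s (simple_calc r x)) x"
      unfolding inner_simple_calc_simple_calc[OF s r]
      using bs(2) br(2) by (intro sum.cong refl integral_sum_indicator) auto
    finally show ?thesis by simp
  qed
qed

text \<open>Symmetry and multiplicativity turn the squared norm into the quadratic form of
  \<open>s\<^sup>2\<close>. This isometry into \<open>L\<^sup>2(mu x)\<close> is what allows passing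
  from simple to arbitrary Borel functions.\<close>

lemma norm_simple_calc:
  assumes s: "simple_function borel s"
  shows "(norm (simple_calc s x))\<^sup>2 = (\<integral>t. (s t)\<^sup>2 \<partial>mu x)"
proof -
  have "(norm (simple_calc s x))\<^sup>2 = inner (simple_calc s (simple_calc s x)) x"
    by (metis symmetric_simple_calc[OF s] power2_norm_eq_inner inner_commute)
  also have "\<dots> = (\<integral>t. s t * s t \<partial>mu x)"
    using simple_calc_mult[OF s s] simple_calc_quadratic[OF simple_function_mult[OF s s]] by simp
  finally show ?thesis by (simp add: power2_eq_square)
qed

end

text \<open>Dominated convergence in \<open>L\<^sup>2\<close> form: the squares are dominated by the
  square of \<open>w\<close>.\<close>

lemma tendsto_integral_square:
  fixes f :: "nat \<Rightarrow> 'm \<Rightarrow> real"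
  assumes [measurable]: "\<And>n. f n \<in> borel_measurable M" "g \<in> borel_measurable M"
    and "AE t in M. (\<lambda>n. f n t) \<longlonglongrightarrow> g t"
    and "\<And>n. AE t in M. \<bar>f n t\<bar> \<le> w t"
    and "integrable M (\<lambda>t. (w t)\<^sup>2)"
  shows "(\<lambda>n. \<integral>t. (f n t)\<^sup>2 \<partial>M) \<longlonglongrightarrow> (\<integral>t. (g t)\<^sup>2 \<partial>M)"
proof (rule integral_dominated_convergence)
  show "AE t in M. (\<lambda>n. (f n t)\<^sup>2) \<longlonglongrightarrow> (g t)\<^sup>2"
    using assms(3) by eventually_elim (rule tendsto_power)
  show "AE t in M. norm ((f n t)\<^sup>2) \<le> (w t)\<^sup>2" for n
    using assms(4)[of n] by eventually_elim (simp add: abs_le_square_iff[symmetric])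
qed (use assms in measurable)

text \<open>The bound lets a multiple of \<open>g\<close> itself dominate every limit taken along
  \<open>s\<close>. The factor 2 is the one supplied by the approximation theorem for functions into
  a metric space.\<close>

definition approx_seq :: "(real \<Rightarrow> real) \<Rightarrow> (nat \<Rightarrow> real \<Rightarrow> real) \<Rightarrow> bool" where
  "approx_seq g s \<longleftrightarrow> (\<forall>n. simple_function borel (s n)) \<and> (\<forall>t. (\<lambda>n. s n t) \<longlonglongrightarrow> g t) \<and>
     (\<forall>n t. \<bar>s n t\<bar> \<le> 2 * \<bar>g t\<bar>)"

lemma approx_seq_exists:
  assumes "g \<in> borel_measurable borel"
  shows "\<exists>s. approx_seq g s"
  using borel_measurable_implies_sequence_metric[OF assms, of 0] by (auto simp: approx_seq_def)

section \<open>Integrals of unbounded Borel functions\<close>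

context pvm
begin

lemma spectral_domain_iff:
  assumes "g \<in> borel_measurable borel"
  shows "x \<in> spectral_domain E g \<longleftrightarrow> (\<integral>\<^sup>+t. ennreal ((g t)\<^sup>2) \<partial>mu x) < \<infinity>"
  using assms unfolding spectral_domain_def by (simp add: integrable_iff_bounded)

text \<open>The parallelogram identity for integrals of \<open>g\<^sup>2\<close> has a finite
  right-hand side, so both terms on the left are finite.\<close>

lemma spectral_domain_add_diff:
  assumes g: "g \<in> borel_measurable borel"
    and x: "x \<in> spectral_domain E g" and z: "z \<in> spectral_domain E g"
  shows "x + z \<in> spectral_domain E g" "x - z \<in> spectral_domain E g"
proof -
  let ?I = "\<lambda>x. \<integral>\<^sup>+t. ennreal ((g t)\<^sup>2) \<partial>mu x"
  have "?I (x + z) + ?I (x - z) = 2 * ?I x + 2 * ?I z"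
    using g by (intro parallelogram_mu) measurable
  also have "\<dots> < \<infinity>" using x z by (simp add: spectral_domain_iff[OF g] ennreal_mult_less_top)
  finally show "x + z \<in> spectral_domain E g" "x - z \<in> spectral_domain E g"
    by (simp_all add: spectral_domain_iff[OF g])
qed

lemma integrable_spectral_domain:
  assumes "g \<in> borel_measurable borel" "x \<in> spectral_domain E g"
  shows "integrable (mu x) g"
proof -
  interpret finite_measure "mu x" by (rule finite_measure_mu)
  have "\<bar>g t\<bar> \<le> 1 + (g t)\<^sup>2" for t
  proof (cases "\<bar>g t\<bar> \<le> 1")
    case False
    then have "\<bar>g t\<bar> * 1 \<le> \<bar>g t\<bar> * \<bar>g t\<bar>" by (intro mult_left_mono) auto
    then show ?thesis by (simp add: power2_eq_square)
  qed (simp add: add_increasing2)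
  then show ?thesis
    using assms unfolding spectral_domain_def
    by (intro Bochner_Integration.integrable_bound[of "mu x" "\<lambda>t. 1 + (g t)\<^sup>2" g]) auto
qed

lemma nn_integral_proj:
  assumes "M \<in> sets borel" "f \<in> borel_measurable borel"
  shows "(\<integral>\<^sup>+t. f t \<partial>mu (E M x)) = (\<integral>\<^sup>+t. indicator M t * f t \<partial>mu x)"
  using assms by (simp add: mu_proj nn_integral_density)

lemma spectral_domain_proj:
  assumes M: "M \<in> sets borel" and g: "g \<in> borel_measurable borel"
    and x: "x \<in> spectral_domain E g"
  shows "E M x \<in> spectral_domain E g"
proof -
  have "(\<integral>\<^sup>+t. indicator M t * ennreal ((g t)\<^sup>2) \<partial>mu x) \<le> (\<integral>\<^sup>+t. ennreal ((g t)\<^sup>2) \<partial>mu x)"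
    by (intro nn_integral_mono) (auto split: split_indicator)
  then show ?thesis
    using x M g by (auto simp: spectral_domain_iff nn_integral_proj intro: order_le_less_trans)
qed

lemma spectral_domain_AE_bounded:
  assumes g: "g \<in> borel_measurable borel" and b: "AE t in mu x. \<bar>g t\<bar> \<le> c"
  shows "x \<in> spectral_domain E g"
proof -
  interpret finite_measure "mu x" by (rule finite_measure_mu)
  show ?thesis
    unfolding spectral_domain_def mem_Collect_eq
  proof (rule integrable_const_bound)
    show "AE t in mu x. norm ((g t)\<^sup>2) \<le> c\<^sup>2"
      using b
    proof eventually_elim
      case (elim t)
      then show ?case using power_mono[OF elim, of 2] by simp
    qed
  qed (use g in simp)
qed

lemma spectral_domain_proj_bounded:
  assumes M: "M \<in> sets borel" and g: "g \<in> borel_measurable borel"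
    and b: "\<And>t. t \<in> M \<Longrightarrow> \<bar>g t\<bar> \<le> c"
  shows "E M x \<in> spectral_domain E g"
proof (rule spectral_domain_AE_bounded[OF g])
  show "AE t in mu (E M x). \<bar>g t\<bar> \<le> c"
    unfolding mu_proj[OF M] using M b by (subst AE_density) (auto simp: indicator_def)
qed

text \<open>For a projection, \<open>\<parallel>E M z - z\<parallel>\<^sup>2 =
  \<parallel>z\<parallel>\<^sup>2 - \<parallel>E M z\<parallel>\<^sup>2\<close>, and the right-hand
  side tends to 0 by continuity of \<open>mu z\<close> from below.\<close>

lemma proj_tendsto:
  assumes M: "\<And>n. M n \<in> sets borel" and inc: "incseq M" and U: "(\<Union>n. M n) = UNIV"
  shows "(\<lambda>n. E (M n) z) \<longlonglongrightarrow> z"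
proof -
  interpret finite_measure "mu z" by (rule finite_measure_mu)
  have "(\<lambda>n. measure (mu z) (M n)) \<longlonglongrightarrow> measure (mu z) (\<Union>n. M n)"
    using M inc by (intro finite_Lim_measure_incseq) auto
  then have "(\<lambda>n. (norm (E (M n) z))\<^sup>2) \<longlonglongrightarrow> (norm z)\<^sup>2"
    using M U by (simp add: measure_mu)
  then have "(\<lambda>n. (norm z)\<^sup>2 - (norm (E (M n) z))\<^sup>2) \<longlonglongrightarrow> (norm z)\<^sup>2 - (norm z)\<^sup>2"
    by (intro tendsto_diff tendsto_const)
  moreover have "(norm (E (M n) z - z))\<^sup>2 = (norm z)\<^sup>2 - (norm (E (M n) z))\<^sup>2" for n
    using proj_quadratic[OF M[of n], of z]
    by (simp add: power2_norm_eq_inner inner_diff_left inner_diff_right inner_commute)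
  ultimately have "(\<lambda>n. (norm (E (M n) z - z))\<^sup>2) \<longlonglongrightarrow> 0" by simp
  then have "(\<lambda>n. norm (E (M n) z - z)) \<longlonglongrightarrow> 0"
    using tendsto_real_sqrt[of "\<lambda>n. (norm (E (M n) z - z))\<^sup>2" 0] by simp
  then show ?thesis by (simp add: LIM_zero_iff tendsto_norm_zero_iff)
qed

text \<open>A cut-off to a set on which \<open>g\<close> is bounded lands in the domain, and the
  sublevel sets exhaust the line. Together the claims say that the domain is dense, which the weak
  definition of \<open>spectral_integral\<close> relies on.\<close>

lemma proj_sublevel:
  assumes g: "g \<in> borel_measurable borel"
  shows "{t. \<bar>g t\<bar> \<le> c} \<in> sets borel"
    "(\<lambda>n. E {t. \<bar>g t\<bar> \<le> real n} z) \<longlonglongrightarrow> z"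
    "E {t. \<bar>g t\<bar> \<le> c} z \<in> spectral_domain E g"
proof -
  show M: "{t. \<bar>g t\<bar> \<le> c} \<in> sets borel" for c
  proof -
    have "{t \<in> space borel. \<bar>g t\<bar> \<le> c} \<in> sets borel" using g by measurable
    then show ?thesis by simp
  qed
  show "(\<lambda>n. E {t. \<bar>g t\<bar> \<le> real n} z) \<longlonglongrightarrow> z"
  proof (rule proj_tendsto[OF M])
    show "incseq (\<lambda>n. {t. \<bar>g t\<bar> \<le> real n})" by (auto simp: incseq_def)
    show "(\<Union>n. {t. \<bar>g t\<bar> \<le> real n}) = UNIV" using real_arch_simple by auto
  qed
  show "E {t. \<bar>g t\<bar> \<le> c} z \<in> spectral_domain E g"
    by (rule spectral_domain_proj_bounded[OF M g]) simp
qed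

text \<open>The difference of two values is orthogonal to the domain; testing with its own cut-offs,
  which converge to it, shows that it vanishes.\<close>

lemma spectral_integral_unique:
  assumes g: "g \<in> borel_measurable borel"
    and "(x, y) \<in> spectral_integral E g" "(x, y') \<in> spectral_integral E g"
  shows "y = y'"
proof -
  have *: "inner (y - y') z = 0" if "z \<in> spectral_domain E g" for z
  proof -
    have "inner u z = ((\<integral>t. g t \<partial>mu (x + z)) - (\<integral>t. g t \<partial>mu (x - z))) / 4"
      if "(x, u) \<in> spectral_integral E g" for u
      using that \<open>z \<in> spectral_domain E g\<close> unfolding spectral_integral_def by blast
    from this[OF assms(2)] this[OF assms(3)] show ?thesis by (simp add: inner_diff_left)
  qed
  have "(\<lambda>n. inner (y - y') (E {t. \<bar>g t\<bar> \<le> real n} (y - y'))) \<longlonglongrightarrow> inner (y - y') (y - y')"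
    by (intro tendsto_intros proj_sublevel(2) g)
  then have "inner (y - y') (y - y') = 0"
    using *[OF proj_sublevel(3)[OF g]] by (simp add: LIMSEQ_const_iff)
  then show ?thesis by simp
qed

lemma approx_seq_measurable:
  "approx_seq g s \<Longrightarrow> s n \<in> borel_measurable borel"
  by (auto simp: approx_seq_def intro: borel_measurable_simple_function)

text \<open>By the isometry the sequence is Cauchy in \<open>X\<close> as soon as \<open>s n\<close>
  converges to \<open>g\<close> in \<open>L\<^sup>2(mu x)\<close>. The latter is dominated
  convergence with \<open>3 * \<bar>g t\<bar>\<close>, the sum of the bounds for \<open>s n\<close>
  and \<open>g\<close>.\<close>

lemma convergent_approx:
  assumes g: "g \<in> borel_measurable borel" and s: "approx_seq g s"
    and x: "x \<in> spectral_domain E g"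
  shows "\<exists>y. (\<lambda>n. simple_calc (s n) x) \<longlonglongrightarrow> y"
proof -
  have simple: "simple_function borel (s n)" for n using s by (simp add: approx_seq_def)
  note sm [measurable] = approx_seq_measurable[OF s]
  note g [measurable]
  have g2: "integrable (mu x) (\<lambda>t. (3 * \<bar>g t\<bar>)\<^sup>2)"
    using x by (simp add: spectral_domain_def power_mult_distrib)
  have bound: "\<bar>s n t - g t\<bar> \<le> 3 * \<bar>g t\<bar>" for n t
  proof -
    have "\<bar>s n t\<bar> \<le> 2 * \<bar>g t\<bar>" using s by (simp add: approx_seq_def)
    then show ?thesis by linarith
  qed
  define a where "a n = (\<integral>t. (s n t - g t)\<^sup>2 \<partial>mu x)" for n
  have "a \<longlonglongrightarrow> (\<integral>t. 0\<^sup>2 \<partial>mu x)"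
    unfolding a_def
  proof (rule tendsto_integral_square[OF _ _ _ _ g2])
    show "AE t in mu x. (\<lambda>n. s n t - g t) \<longlonglongrightarrow> 0"
      using s by (intro AE_I2) (simp add: approx_seq_def LIM_zero)
  qed (use bound in auto)
  then have a0: "a \<longlonglongrightarrow> 0" by simp
  have int: "integrable (mu x) (\<lambda>t. (s n t - g t)\<^sup>2)" for n
  proof (rule Bochner_Integration.integrable_bound[OF g2])
    show "AE t in mu x. norm ((s n t - g t)\<^sup>2) \<le> norm ((3 * \<bar>g t\<bar>)\<^sup>2)"
      using power_mono[OF bound[of n] abs_ge_zero, of _ 2] by (intro AE_I2) simp
  qed simp
  have est: "(norm (simple_calc (s m) x - simple_calc (s n) x))\<^sup>2 \<le> 2 * a m + 2 * a n" for m n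
  proof -
    have "(norm (simple_calc (s m) x - simple_calc (s n) x))\<^sup>2 = (\<integral>t. (s m t - s n t)\<^sup>2 \<partial>mu x)"
      by (simp add: simple_calc_diff[OF simple simple, symmetric]
          norm_simple_calc[OF simple_function_diff[OF simple simple]])
    also have "\<dots> \<le> (\<integral>t. 2 * (s m t - g t)\<^sup>2 + 2 * (s n t - g t)\<^sup>2 \<partial>mu x)"
    proof (rule integral_mono)
      show "integrable (mu x) (\<lambda>t. (s m t - s n t)\<^sup>2)"
        using integrable_simple[of "\<lambda>t. (s m t - s n t) * (s m t - s n t)" x]
          simple_function_mult simple_function_diff simple
        by (simp add: power2_eq_square)
      fix t
      have "0 \<le> ((s m t - g t) + (s n t - g t))\<^sup>2" by simp
      then show "(s m t - s n t)\<^sup>2 \<le> 2 * (s m t - g t)\<^sup>2 + 2 * (s n t - g t)\<^sup>2"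
        by (simp add: power2_eq_square algebra_simps)
    qed (use int in auto)
    also have "\<dots> = 2 * a m + 2 * a n" unfolding a_def using int by simp
    finally show ?thesis .
  qed
  have "Cauchy (\<lambda>n. simple_calc (s n) x)"
  proof (rule CauchyI)
    fix e :: real assume "e > 0"
    then have "e\<^sup>2 / 4 > 0" by simp
    with a0 obtain N where N: "\<And>n. n \<ge> N \<Longrightarrow> a n < e\<^sup>2 / 4"
      by (metis (no_types, lifting) eventually_sequentially order_tendstoD(2))
    show "\<exists>N. \<forall>m\<ge>N. \<forall>n\<ge>N. norm (simple_calc (s m) x - simple_calc (s n) x) < e"
    proof (intro exI allI impI)
      fix m n assume "m \<ge> N" "n \<ge> N"
      then have "2 * a m + 2 * a n < 2 * (e\<^sup>2/4) + 2 * (e\<^sup>2/4)"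
        using N by (intro add_strict_mono mult_strict_left_mono) auto
      then have "(norm (simple_calc (s m) x - simple_calc (s n) x))\<^sup>2 < e\<^sup>2"
        using est[of m n] by simp
      then show "norm (simple_calc (s m) x - simple_calc (s n) x) < e"
        using \<open>e > 0\<close> by (simp add: power2_less_imp_less)
    qed
  qed
  then show ?thesis using Cauchy_convergent_iff convergent_def by blast
qed

text \<open>For simple functions the defining identity is polarization. It passes to the limit
  because \<open>x + z\<close> and \<open>x - z\<close> lie in the domain, so that \<open>g\<close>
  is integrable for their scalar measures and dominates.\<close>

lemma approx_limit_in_spectral_integral:
  assumes g: "g \<in> borel_measurable borel" and s: "approx_seq g s"
    and x: "x \<in> spectral_domain E g" and y: "(\<lambda>n. simple_calc (s n) x) \<longlonglongrightarrow> y"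
  shows "(x, y) \<in> spectral_integral E g"
  unfolding spectral_integral_def
proof (clarify, intro conjI ballI x)
  fix z assume z: "z \<in> spectral_domain E g"
  have simple: "simple_function borel (s n)" for n using s by (simp add: approx_seq_def)
  note sm [measurable] = approx_seq_measurable[OF s]
  note g [measurable]
  have lim: "(\<lambda>n. \<integral>t. s n t \<partial>mu u) \<longlonglongrightarrow> (\<integral>t. g t \<partial>mu u)" if u: "u \<in> spectral_domain E g" for u
  proof (rule integral_dominated_convergence)
    show "integrable (mu u) (\<lambda>t. 2 * \<bar>g t\<bar>)"
      using integrable_spectral_domain[OF g u] by simp
    show "AE t in mu u. (\<lambda>n. s n t) \<longlonglongrightarrow> g t" "AE t in mu u. norm (s n t) \<le> 2 * \<bar>g t\<bar>" for n
      using s by (auto simp: approx_seq_def)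
  qed measurable
  have "(\<lambda>n. inner (simple_calc (s n) x) z)
      \<longlonglongrightarrow> ((\<integral>t. g t \<partial>mu (x + z)) - (\<integral>t. g t \<partial>mu (x - z))) / 4"
    unfolding polarization[OF linear_simple_calc[OF simple] symmetric_simple_calc[OF simple], of _ x z]
      simple_calc_quadratic[OF simple]
    by (intro tendsto_intros lim spectral_domain_add_diff g x z) simp
  moreover have "(\<lambda>n. inner (simple_calc (s n) x) z) \<longlonglongrightarrow> inner y z"
    by (intro tendsto_intros y)
  ultimately show "inner y z = ((\<integral>t. g t \<partial>mu (x + z)) - (\<integral>t. g t \<partial>mu (x - z))) / 4"
    by (rule LIMSEQ_unique[rotated])
qed

lemma spectral_integral_total:
  assumes "g \<in> borel_measurable borel" "x \<in> spectral_domain E g"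
  shows "\<exists>y. (x, y) \<in> spectral_integral E g"
  using assms approx_seq_exists convergent_approx approx_limit_in_spectral_integral by meson

lemma spectral_integral_domain: "(x, y) \<in> spectral_integral E g \<Longrightarrow> x \<in> spectral_domain E g"
  by (simp add: spectral_integral_def)

text \<open>The limit along any approximating sequence is a value of the weakly defined operator,
  and values are unique. Through this strong limit the rules of the simple calculus carry over to
  \<open>g\<close>.\<close>

lemma spectral_integral_approx:
  assumes "g \<in> borel_measurable borel" "approx_seq g s" "(x, y) \<in> spectral_integral E g"
  shows "(\<lambda>n. simple_calc (s n) x) \<longlonglongrightarrow> y"
  using assms spectral_integral_domain spectral_integral_unique convergent_approx
    approx_limit_in_spectral_integral by metis

lemma spectral_integral_diff:
  assumes g: "g \<in> borel_measurable borel"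
    and x: "(x, y) \<in> spectral_integral E g" and x': "(x', y') \<in> spectral_integral E g"
  shows "(x - x', y - y') \<in> spectral_integral E g"
proof -
  obtain s where s: "approx_seq g s" using approx_seq_exists[OF g] by blast
  have "linear (simple_calc (s n))" for n
    using s by (intro linear_simple_calc) (simp add: approx_seq_def)
  then have "(\<lambda>n. simple_calc (s n) (x - x')) = (\<lambda>n. simple_calc (s n) x - simple_calc (s n) x')"
    by (simp add: linear_diff)
  moreover have "(\<lambda>n. simple_calc (s n) x - simple_calc (s n) x') \<longlonglongrightarrow> y - y'"
    by (intro tendsto_intros spectral_integral_approx[OF g s] x x')
  ultimately show ?thesis
    using approx_limit_in_spectral_integral[OF g s] spectral_domain_add_diff(2)[OF g]
      spectral_integral_domain x x' by metis
qed

lemma spectral_integral_proj: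
  assumes M: "M \<in> sets borel" and g: "g \<in> borel_measurable borel"
    and x: "(x, y) \<in> spectral_integral E g"
  shows "(E M x, E M y) \<in> spectral_integral E g"
proof -
  obtain s where s: "approx_seq g s" using approx_seq_exists[OF g] by blast
  have "(\<lambda>n. E M (simple_calc (s n) x)) \<longlonglongrightarrow> E M y"
    using bounded_linear.tendsto[OF proj_bounded_linear[OF M] spectral_integral_approx[OF g s x]] .
  moreover have "E M (simple_calc (s n) x) = simple_calc (s n) (E M x)" for n
    using s by (intro proj_simple_calc M) (simp add: approx_seq_def)
  ultimately show ?thesis
    using approx_limit_in_spectral_integral[OF g s] spectral_domain_proj[OF M g]
      spectral_integral_domain[OF x] by simp
qed

lemma spectral_integral_norm:
  assumes g: "g \<in> borel_measurable borel" and x: "(x, y) \<in> spectral_integral E g"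
  shows "(norm y)\<^sup>2 = (\<integral>t. (g t)\<^sup>2 \<partial>mu x)"
proof -
  obtain s where s: "approx_seq g s" using approx_seq_exists[OF g] by blast
  note sm [measurable] = approx_seq_measurable[OF s]
  note g [measurable]
  have "(\<lambda>n. (norm (simple_calc (s n) x))\<^sup>2) \<longlonglongrightarrow> (norm y)\<^sup>2"
    by (intro tendsto_intros spectral_integral_approx[OF g s x])
  moreover have "(norm (simple_calc (s n) x))\<^sup>2 = (\<integral>t. (s n t)\<^sup>2 \<partial>mu x)" for n
    using s by (intro norm_simple_calc) (simp add: approx_seq_def)
  moreover have "(\<lambda>n. \<integral>t. (s n t)\<^sup>2 \<partial>mu x) \<longlonglongrightarrow> (\<integral>t. (g t)\<^sup>2 \<partial>mu x)"
  proof (rule tendsto_integral_square)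
    show "integrable (mu x) (\<lambda>t. (2 * \<bar>g t\<bar>)\<^sup>2)"
      using spectral_integral_domain[OF x] by (simp add: spectral_domain_def power_mult_distrib)
  qed (use s in \<open>auto simp: approx_seq_def\<close>)
  ultimately show ?thesis using LIMSEQ_unique by simp
qed

lemma spectral_integral_inner:
  assumes g: "g \<in> borel_measurable borel" and x: "(x, y) \<in> spectral_integral E g"
  shows "inner y x = (\<integral>t. g t \<partial>mu x)"
proof -
  obtain s where s: "approx_seq g s" using approx_seq_exists[OF g] by blast
  note sm [measurable] = approx_seq_measurable[OF s]
  note g [measurable]
  have "(\<lambda>n. inner (simple_calc (s n) x) x) \<longlonglongrightarrow> inner y x"
    by (intro tendsto_intros spectral_integral_approx[OF g s x])
  moreover have "inner (simple_calc (s n) x) x = (\<integral>t. s n t \<partial>mu x)" for n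
    using s by (intro simple_calc_quadratic) (simp add: approx_seq_def)
  moreover have "(\<lambda>n. \<integral>t. s n t \<partial>mu x) \<longlonglongrightarrow> (\<integral>t. g t \<partial>mu x)"
  proof (rule integral_dominated_convergence)
    show "integrable (mu x) (\<lambda>t. 2 * \<bar>g t\<bar>)"
      using integrable_spectral_domain[OF g spectral_integral_domain[OF x]] by simp
  qed (use s in \<open>auto simp: approx_seq_def\<close>)
  ultimately show ?thesis using LIMSEQ_unique by simp
qed

text \<open>The isometry, applied to the pair \<open>(E M x, E M y)\<close>, evaluates
  \<open>mu y\<close> on \<open>M\<close>.\<close>

lemma mu_spectral_integral:
  assumes g: "g \<in> borel_measurable borel" and x: "(x, y) \<in> spectral_integral E g"
  shows "mu y = density (mu x) (\<lambda>t. ennreal ((g t)\<^sup>2))"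
proof (rule measure_eqI)
  fix M assume "M \<in> sets (mu y)"
  then have M: "M \<in> sets borel" by simp
  note p = spectral_integral_proj[OF M g x]
  note g [measurable]
  have "emeasure (mu y) M = ennreal (\<integral>t. (g t)\<^sup>2 \<partial>mu (E M x))"
    using M spectral_integral_norm[OF g p] by (simp add: emeasure_mu)
  also have "\<dots> = (\<integral>\<^sup>+t. ennreal ((g t)\<^sup>2) \<partial>mu (E M x))"
    using spectral_integral_domain[OF p] by (subst nn_integral_eq_integral) (auto simp: spectral_domain_def)
  also have "\<dots> = emeasure (density (mu x) (\<lambda>t. ennreal ((g t)\<^sup>2))) M"
    using M g by (subst nn_integral_proj) (auto simp: emeasure_density mult.commute)
  finally show "emeasure (mu y) M = emeasure (density (mu x) (\<lambda>t. ennreal ((g t)\<^sup>2))) M" .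
qed simp

lemma bounded_linear_simple_calc:
  assumes "simple_function borel s"
  shows "bounded_linear (simple_calc s)"
  unfolding simple_calc_def
  by (intro bounded_linear_sum bounded_linear_const_scaleR proj_bounded_linear simple_borel(2) assms)

text \<open>The product formula passes to the limit in one factor at a time, the first limit being taken
  for a fixed simple, hence bounded, second factor.\<close>

lemma spectral_integral_compose:
  assumes g: "g \<in> borel_measurable borel" and h: "h \<in> borel_measurable borel"
    and xy: "(x, y) \<in> spectral_integral E g" and yz: "(y, z) \<in> spectral_integral E h"
  shows "(x, z) \<in> spectral_integral E (\<lambda>t. g t * h t)"
proof -
  let ?gh = "\<lambda>t. g t * h t"
  note [measurable] = g h
  have gh: "?gh \<in> borel_measurable borel" by measurable
  \<comment> \<open>\<open>mu y\<close> has density \<open>g\<^sup>2\<close> with respect to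
    \<open>mu x\<close>, so membership of \<open>y\<close> in the domain of \<open>h\<close> is
    membership of \<open>x\<close> in the domain of the product.\<close>
  have "(\<integral>\<^sup>+t. ennreal ((g t * h t)\<^sup>2) \<partial>mu x) = (\<integral>\<^sup>+t. ennreal ((h t)\<^sup>2) \<partial>mu y)"
    unfolding mu_spectral_integral[OF g xy]
    by (subst nn_integral_density) (auto simp: ennreal_mult power_mult_distrib)
  then have xgh: "x \<in> spectral_domain E ?gh"
    using spectral_integral_domain[OF yz] by (simp add: spectral_domain_iff[OF gh] spectral_domain_iff[OF h])
  then obtain u where u: "(x, u) \<in> spectral_integral E ?gh"
    using spectral_integral_total[OF gh] by blast
  obtain s where s: "approx_seq g s" using approx_seq_exists[OF g] by blast
  obtain r where r: "approx_seq h r" using approx_seq_exists[OF h] by blast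
  obtain q where q: "approx_seq ?gh q" using approx_seq_exists[OF gh] by blast
  have simple: "simple_function borel (s n)" "simple_function borel (r n)" "simple_function borel (q n)" for n
    using s r q by (auto simp: approx_seq_def)
  note [measurable] = approx_seq_measurable[OF s] approx_seq_measurable[OF r] approx_seq_measurable[OF q]
  have g2: "integrable (mu x) (\<lambda>t. (g t)\<^sup>2)"
    using spectral_integral_domain[OF xy] by (simp add: spectral_domain_def)
  have gh2: "integrable (mu x) (\<lambda>t. (g t * h t)\<^sup>2)"
    using xgh by (simp add: spectral_domain_def)
  have dist: "(norm (simple_calc (r n) y - u))\<^sup>2 = (\<integral>t. (r n t * g t - g t * h t)\<^sup>2 \<partial>mu x)" for n
  proof -
    have "finite (range (r n))" using simple_borel(1)[OF simple(2)] .
    then obtain C where C: "\<And>t. \<bar>r n t\<bar> \<le> C"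
      using bounded_iff finite_imp_bounded by (metis rangeI real_norm_def)
    have C0: "0 \<le> C" using C[of 0] by linarith
    have "(\<lambda>m. (norm (simple_calc (r n) (simple_calc (s m) x) - simple_calc (q m) x))\<^sup>2)
        \<longlonglongrightarrow> (norm (simple_calc (r n) y - u))\<^sup>2"
      by (intro tendsto_intros spectral_integral_approx[OF gh q u]
          bounded_linear.tendsto[OF bounded_linear_simple_calc[OF simple(2)]]
          spectral_integral_approx[OF g s xy])
    moreover have "(norm (simple_calc (r n) (simple_calc (s m) x) - simple_calc (q m) x))\<^sup>2
      = (\<integral>t. (r n t * s m t - q m t)\<^sup>2 \<partial>mu x)" for m
      by (simp add: simple simple_calc_mult[symmetric] simple_calc_diff[symmetric] simple_function_mult
          simple_function_diff norm_simple_calc)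
    moreover have "(\<lambda>m. \<integral>t. (r n t * s m t - q m t)\<^sup>2 \<partial>mu x)
        \<longlonglongrightarrow> (\<integral>t. (r n t * g t - g t * h t)\<^sup>2 \<partial>mu x)"
    proof (rule tendsto_integral_square)
      show "AE t in mu x. (\<lambda>m. r n t * s m t - q m t) \<longlonglongrightarrow> r n t * g t - g t * h t"
        using s q by (intro AE_I2 tendsto_intros) (auto simp: approx_seq_def)
      show "AE t in mu x. \<bar>r n t * s m t - q m t\<bar> \<le> 2 * C * \<bar>g t\<bar> + 2 * \<bar>g t * h t\<bar>" for m
      proof (rule AE_I2)
        fix t
        have "\<bar>r n t * s m t\<bar> \<le> C * (2 * \<bar>g t\<bar>)"
          unfolding abs_mult using C C0 s by (intro mult_mono) (auto simp: approx_seq_def)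
        moreover have "\<bar>q m t\<bar> \<le> 2 * \<bar>g t * h t\<bar>" using q by (auto simp: approx_seq_def)
        ultimately show "\<bar>r n t * s m t - q m t\<bar> \<le> 2 * C * \<bar>g t\<bar> + 2 * \<bar>g t * h t\<bar>" by linarith
      qed
      show "integrable (mu x) (\<lambda>t. (2 * C * \<bar>g t\<bar> + 2 * \<bar>g t * h t\<bar>)\<^sup>2)"
      proof (rule Bochner_Integration.integrable_bound)
        \<comment> \<open>The constants come from
          \<open>(a + b)\<^sup>2 \<le> 2 * a\<^sup>2 + 2 * b\<^sup>2\<close>.\<close>
        show "integrable (mu x) (\<lambda>t. 8 * C\<^sup>2 * (g t)\<^sup>2 + 8 * (g t * h t)\<^sup>2)"
          using g2 gh2 by simp
        show "AE t in mu x. norm ((2 * C * \<bar>g t\<bar> + 2 * \<bar>g t * h t\<bar>)\<^sup>2)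
            \<le> norm (8 * C\<^sup>2 * (g t)\<^sup>2 + 8 * (g t * h t)\<^sup>2)"
        proof (rule AE_I2)
          fix t
          have "0 \<le> (2 * C * \<bar>g t\<bar> - 2 * \<bar>g t * h t\<bar>)\<^sup>2" by simp
          moreover have "\<bar>g t\<bar>\<^sup>2 = (g t)\<^sup>2" "\<bar>g t * h t\<bar>\<^sup>2 = (g t * h t)\<^sup>2" by simp_all
          ultimately have "(2 * C * \<bar>g t\<bar> + 2 * \<bar>g t * h t\<bar>)\<^sup>2 \<le> 8 * C\<^sup>2 * (g t)\<^sup>2 + 8 * (g t * h t)\<^sup>2"
            by (simp only: power2_sum power2_diff power_mult_distrib) simp
          then show "norm ((2 * C * \<bar>g t\<bar> + 2 * \<bar>g t * h t\<bar>)\<^sup>2)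
            \<le> norm (8 * C\<^sup>2 * (g t)\<^sup>2 + 8 * (g t * h t)\<^sup>2)" by simp
        qed
      qed measurable
    qed measurable
    ultimately show ?thesis using LIMSEQ_unique by simp
  qed
  \<comment> \<open>Now the second factor varies:
    \<open>\<bar>r n t\<bar> \<le> 2 * \<bar>h t\<bar>\<close> makes
    \<open>3 * \<bar>g t * h t\<bar>\<close> a dominating function independent of
    \<open>n\<close>.\<close>
  have "(\<lambda>n. \<integral>t. (r n t * g t - g t * h t)\<^sup>2 \<partial>mu x) \<longlonglongrightarrow> (\<integral>t. 0\<^sup>2 \<partial>mu x)"
  proof (rule tendsto_integral_square)
    show "AE t in mu x. (\<lambda>n. r n t * g t - g t * h t) \<longlonglongrightarrow> 0"
    proof (rule AE_I2)
      fix t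
      have "(\<lambda>n. r n t * g t - g t * h t) \<longlonglongrightarrow> h t * g t - g t * h t"
        using r by (intro tendsto_intros) (auto simp: approx_seq_def)
      then show "(\<lambda>n. r n t * g t - g t * h t) \<longlonglongrightarrow> 0" by (simp add: mult.commute)
    qed
    show "AE t in mu x. \<bar>r n t * g t - g t * h t\<bar> \<le> 3 * \<bar>g t * h t\<bar>" for n
    proof (rule AE_I2)
      fix t
      have "\<bar>r n t * g t\<bar> \<le> 2 * \<bar>h t\<bar> * \<bar>g t\<bar>"
        unfolding abs_mult using r by (intro mult_right_mono) (auto simp: approx_seq_def)
      then show "\<bar>r n t * g t - g t * h t\<bar> \<le> 3 * \<bar>g t * h t\<bar>"
        unfolding abs_mult using abs_triangle_ineq4[of "r n t * g t" "g t * h t"]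
        by (simp add: abs_mult mult.commute)
    qed
    show "integrable (mu x) (\<lambda>t. (3 * \<bar>g t * h t\<bar>)\<^sup>2)"
      using gh2 by (simp add: power_mult_distrib)
  qed measurable
  then have "(\<lambda>n. (norm (simple_calc (r n) y - u))\<^sup>2) \<longlonglongrightarrow> 0" by (simp add: dist)
  then have "(\<lambda>n. norm (simple_calc (r n) y - u)) \<longlonglongrightarrow> 0"
    using tendsto_real_sqrt[of "\<lambda>n. (norm (simple_calc (r n) y - u))\<^sup>2" 0] by simp
  then have "(\<lambda>n. simple_calc (r n) y) \<longlonglongrightarrow> u" by (simp add: LIM_zero_iff tendsto_norm_zero_iff)
  then have "u = z" using spectral_integral_approx[OF h r yz] LIMSEQ_unique by blast
  then show ?thesis using u by simp
qed

text \<open>The hypothesis ranges over all vectors because the definition also integrates over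
  \<open>mu (x + z)\<close> and \<open>mu (x - z)\<close>.\<close>

lemma spectral_integral_cong_AE:
  assumes g: "g \<in> borel_measurable borel" "h \<in> borel_measurable borel"
    and eq: "\<And>x. AE t in mu x. g t = h t"
  shows "spectral_integral E g = spectral_integral E h"
proof -
  have i: "(\<integral>t. g t \<partial>mu x) = (\<integral>t. h t \<partial>mu x)" for x
    using g eq by (intro integral_cong_AE) auto
  have "integrable (mu x) (\<lambda>t. (g t)\<^sup>2) = integrable (mu x) (\<lambda>t. (h t)\<^sup>2)" for x
    using g eq[of x] by (intro integrable_cong_AE) (auto elim!: eventually_mono)
  then have "spectral_domain E g = spectral_domain E h" by (auto simp: spectral_domain_def)
  then show ?thesis unfolding spectral_integral_def i by simp
qed

lemma spectral_integral_one: "(x, x) \<in> spectral_integral E (\<lambda>t. 1)"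
proof -
  have "measure (mu u) UNIV = inner u u" for u
    by (simp add: measure_mu power2_norm_eq_inner)
  moreover have "x \<in> spectral_domain E (\<lambda>t. 1)"
    by (rule spectral_domain_AE_bounded[where c = 1]) auto
  ultimately show ?thesis
    unfolding spectral_integral_def
    by (simp add: inner_add_left inner_add_right inner_diff_left inner_diff_right inner_commute)
qed

text \<open>The integral of \<open>h\<^sup>2\<close> over \<open>mu y\<close> is that of
  \<open>(g * h)\<^sup>2 = 1\<close> over \<open>mu x\<close>, hence finite. So \<open>y\<close>
  lies in the domain of \<open>h\<close> even if \<open>h\<close> is unbounded, and the product rule
  gives the identity operator.\<close>

lemma spectral_integral_inverse:
  assumes g: "g \<in> borel_measurable borel" and h: "h \<in> borel_measurable borel"
    and one: "\<And>x. AE t in mu x. g t * h t = 1"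
    and xy: "(x, y) \<in> spectral_integral E g"
  shows "(y, x) \<in> spectral_integral E h"
proof -
  note [measurable] = g h
  have "(\<integral>\<^sup>+t. ennreal ((h t)\<^sup>2) \<partial>mu y) = (\<integral>\<^sup>+t. ennreal ((g t * h t)\<^sup>2) \<partial>mu x)"
    unfolding mu_spectral_integral[OF g xy]
    by (subst nn_integral_density) (auto simp: ennreal_mult power_mult_distrib)
  also have "\<dots> = (\<integral>\<^sup>+t. 1 \<partial>mu x)"
    using one[of x] by (intro nn_integral_cong_AE) (auto elim!: eventually_mono)
  also have "\<dots> < \<infinity>" by (simp add: emeasure_mu)
  finally obtain z where z: "(y, z) \<in> spectral_integral E h"
    using spectral_integral_total[OF h] by (auto simp: spectral_domain_iff[OF h])
  have "(x, z) \<in> spectral_integral E (\<lambda>t. g t * h t)" by (rule spectral_integral_compose[OF g h xy z])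
  also have "spectral_integral E (\<lambda>t. g t * h t) = spectral_integral E (\<lambda>t. 1)"
    using one by (intro spectral_integral_cong_AE) auto
  finally have "z = x" using spectral_integral_unique spectral_integral_one borel_measurable_const by blast
  then show ?thesis using z by simp
qed

end

section \<open>Images of projection-valued measures\<close>

lemma (in pvm) projection_valued_measure_image:
  assumes f: "f \<in> borel_measurable borel"
  shows "projection_valued_measure (\<lambda>M. E (f -` M))"
proof -
  have v: "f -` M \<in> sets borel" if "M \<in> sets borel" for M
    using measurable_sets[OF f that] by simp
  show ?thesis
    using pvm unfolding projection_valued_measure_def
  proof (elim conjE, intro conjI allI ballI impI)
    fix M :: "nat \<Rightarrow> real set" and x assume M: "range M \<subseteq> sets borel" "disjoint_family M"
    have "(\<lambda>n. E (f -` M n) x) sums E (\<Union>n. f -` M n) x"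
      using M v by (intro proj_sums) (auto simp: disjoint_family_on_def)
    then show "(\<lambda>n. E (f -` M n) x) sums E (f -` (\<Union>n. M n)) x" by (simp add: vimage_UN)
  qed (auto simp: v)
qed

lemma (in pvm) scalar_measure_image:
  assumes f: "f \<in> borel_measurable borel"
  shows "scalar_measure (\<lambda>M. E (f -` M)) x = distr (mu x) borel f"
proof (rule measure_eqI)
  interpret F: pvm "\<lambda>M. E (f -` M)"
    using projection_valued_measure_image[OF f] by unfold_locales
  show "sets (F.mu x) = sets (distr (mu x) borel f)" by simp
  fix M assume "M \<in> sets (F.mu x)"
  then have M: "M \<in> sets borel" by simp
  then have "f -` M \<in> sets borel" using measurable_sets[OF f] by simp
  then show "emeasure (F.mu x) M = emeasure (distr (mu x) borel f) M"
    using M f by (simp add: F.emeasure_mu emeasure_mu emeasure_distr)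
qed

text \<open>Change of variables in the scalar measures. With \<open>f = inverse\<close> it expresses
  functions of \<open>A\<^sup>* A\<close> through the spectral measure of \<open>T\<close>.\<close>

lemma (in pvm) spectral_integral_image:
  assumes [measurable]: "f \<in> borel_measurable borel" "g \<in> borel_measurable borel"
  shows "spectral_integral (\<lambda>M. E (f -` M)) g = spectral_integral E (\<lambda>t. g (f t))"
proof -
  have "integrable (distr (mu x) borel f) (\<lambda>t. (g t)\<^sup>2) = integrable (mu x) (\<lambda>t. (g (f t))\<^sup>2)" for x
    by (rule integrable_distr_eq) simp_all
  moreover have "(\<integral>t. g t \<partial>distr (mu x) borel f) = (\<integral>t. g (f t) \<partial>mu x)" for x
    by (rule integral_distr) simp_all
  ultimately show ?thesis
    unfolding spectral_integral_def spectral_domain_def scalar_measure_image[OF assms(1)] by simp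
qed

section \<open>Uniqueness of the spectral measure of a bounded operator\<close>

text \<open>Equal moments give equal integrals of polynomials, then of continuous functions by
  Weierstrass approximation on \<open>{-K..K}\<close>, then equal masses of the half-lines
  \<open>{a<..}\<close>, which determine a finite Borel measure.\<close>

lemma measure_eqI_moments:
  fixes M N :: "real measure"
  assumes fin: "finite_measure M" "finite_measure N"
    and sets: "sets M = sets borel" "sets N = sets borel"
    and b: "AE t in M. \<bar>t\<bar> \<le> K" "AE t in N. \<bar>t\<bar> \<le> K"
    and moments: "\<And>n::nat. (\<integral>t. t ^ n \<partial>M) = (\<integral>t. t ^ n \<partial>N)"
  shows "M = N"
proof -
  have int: "integrable L f"
    if L: "finite_measure L" "sets L = sets borel" "AE t in L. \<bar>t\<bar> \<le> K"
      and f: "continuous_on UNIV f" for L and f :: "real \<Rightarrow> real"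
  proof -
    interpret finite_measure L by fact
    have "bounded (f ` {-K..K})"
      using f by (intro compact_imp_bounded compact_continuous_image) (auto intro: continuous_on_subset)
    then obtain C where "\<forall>u\<in>f ` {-K..K}. norm u \<le> C" unfolding bounded_iff by blast
    then have C: "norm (f t) \<le> C" if "t \<in> {-K..K}" for t using that by blast
    show ?thesis
    proof (rule integrable_const_bound)
      show "AE t in L. norm (f t) \<le> C" using L(3) by eventually_elim (intro C, auto)
      show "f \<in> borel_measurable L"
        unfolding measurable_cong_sets[OF L(2) refl] by (rule borel_measurable_continuous_onI[OF f])
    qed
  qed
  note intM = int[OF fin(1) sets(1) b(1)] and intN = int[OF fin(2) sets(2) b(2)]
  have poly: "(\<integral>t. p t \<partial>M) = (\<integral>t. p t \<partial>N)" if poly: "real_polynomial_function p" for p :: "real \<Rightarrow> real"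
  proof -
    obtain a n where p: "p = (\<lambda>t. \<Sum>i\<le>n. a i * t ^ i)"
      using poly[unfolded real_polynomial_function_iff_sum] by (elim exE)
    have "(\<integral>t. p t \<partial>M) = (\<Sum>i\<le>n. \<integral>t. a i * t ^ i \<partial>M)"
      unfolding p by (intro Bochner_Integration.integral_sum intM continuous_intros)
    also have "\<dots> = (\<Sum>i\<le>n. \<integral>t. a i * t ^ i \<partial>N)" by (simp add: moments)
    also have "\<dots> = (\<integral>t. p t \<partial>N)"
      unfolding p by (intro Bochner_Integration.integral_sum[symmetric] intN continuous_intros)
    finally show ?thesis .
  qed
  have cont: "(\<integral>t. f t \<partial>M) = (\<integral>t. f t \<partial>N)" if f: "continuous_on UNIV f" for f :: "real \<Rightarrow> real"
  proof -
    define m where "m = measure M (space M) + measure N (space N)"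
    have "\<bar>(\<integral>t. f t \<partial>M) - (\<integral>t. f t \<partial>N)\<bar> \<le> e * m" if "e > 0" for e
    proof -
      have "continuous_on {-K..K} f" using f by (rule continuous_on_subset) simp
      then obtain p where p: "real_polynomial_function p" "\<And>t. t \<in> {-K..K} \<Longrightarrow> \<bar>f t - p t\<bar> < e"
        using Stone_Weierstrass_real_polynomial_function[of "{-K..K}" f e] \<open>e > 0\<close> by blast
      have pc: "continuous_on UNIV p"
        using p(1) continuous_on_polymonial_function real_polynomial_function_eq by blast
      have close: "\<bar>(\<integral>t. f t \<partial>L) - (\<integral>t. p t \<partial>L)\<bar> \<le> e * measure L (space L)"
        if L: "finite_measure L" "sets L = sets borel" "AE t in L. \<bar>t\<bar> \<le> K" for L
      proof -
        interpret finite_measure L by fact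
        note i = int[OF L]
        have "\<bar>\<integral>t. f t - p t \<partial>L\<bar> \<le> (\<integral>t. \<bar>f t - p t\<bar> \<partial>L)" by (rule integral_abs_bound)
        also have "\<dots> \<le> (\<integral>t. e \<partial>L)"
        proof (rule integral_mono_AE)
          show "AE t in L. \<bar>f t - p t\<bar> \<le> e"
            using L(3) by eventually_elim (intro less_imp_le p(2), auto)
        qed (use i f pc in \<open>auto intro!: continuous_intros\<close>)
        finally show ?thesis using i[OF f] i[OF pc] by (simp add: mult.commute)
      qed
      show ?thesis
        using close[OF fin(1) sets(1) b(1)] close[OF fin(2) sets(2) b(2)] poly[OF p(1)]
        unfolding m_def by (simp add: distrib_left)
    qed
    then have "\<bar>(\<integral>t. f t \<partial>M) - (\<integral>t. f t \<partial>N)\<bar> \<le> 0 + d" if "d > 0" for d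
    proof -
      have "0 \<le> m" unfolding m_def by simp
      \<comment> \<open>The estimate is used with \<open>e = d / (m + 1)\<close>; the added 1 keeps
        the denominator positive if both measures vanish.\<close>
      then have "d / (m + 1) * m \<le> d" using that by (simp add: field_simps)
      moreover have "d / (m + 1) > 0" using that \<open>0 \<le> m\<close> by simp
      ultimately show ?thesis
        using \<open>\<And>e. e > 0 \<Longrightarrow> \<bar>(\<integral>t. f t \<partial>M) - (\<integral>t. f t \<partial>N)\<bar> \<le> e * m\<close>[of "d / (m + 1)"] by simp
    qed
    then have "\<bar>(\<integral>t. f t \<partial>M) - (\<integral>t. f t \<partial>N)\<bar> \<le> 0" by (rule field_le_epsilon)
    then show ?thesis by simp
  qed
  \<comment> \<open>These continuous ramps, with values in \<open>[0, 1]\<close>, converge pointwise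
    to the indicator of \<open>{a<..}\<close>.\<close>
  have meas: "(\<lambda>n::nat. \<integral>t. max 0 (min 1 (real n * (t - a))) \<partial>L) \<longlonglongrightarrow> measure L {a<..}"
    if L: "finite_measure L" "sets L = sets borel" for L a
  proof -
    interpret finite_measure L by fact
    have "(\<lambda>n::nat. \<integral>t. max 0 (min 1 (real n * (t - a))) \<partial>L) \<longlonglongrightarrow> (\<integral>t. indicator {a<..} t \<partial>L)"
    proof (rule integral_dominated_convergence[where w = "\<lambda>t. 1"])
      show "AE t in L. (\<lambda>n. max 0 (min 1 (real n * (t - a)))) \<longlonglongrightarrow> indicator {a<..} t"
      proof (rule AE_I2)
        fix t
        show "(\<lambda>n. max 0 (min 1 (real n * (t - a)))) \<longlonglongrightarrow> indicator {a<..} t"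
        proof (cases "a < t")
          case True
          obtain k :: nat where k: "1 / (t - a) < real k" using reals_Archimedean2 by blast
          have "max 0 (min 1 (real n * (t - a))) = 1" if "n \<ge> k" for n
          proof -
            have "1 / (t - a) \<le> real n" using k that by linarith
            then have "1 \<le> real n * (t - a)" using True by (simp add: divide_le_eq)
            then show ?thesis by simp
          qed
          then have "eventually (\<lambda>n. max 0 (min 1 (real n * (t - a))) = 1) sequentially"
            by (auto simp: eventually_sequentially)
          then show ?thesis using True by (simp add: tendsto_eventually)
        next
          case False
          then have "real n * (t - a) \<le> 0" for n by (simp add: mult_nonneg_nonpos)
          then have "max 0 (min 1 (real n * (t - a))) = 0" for n by (metis max.absorb1 min.coboundedI2)
          then show ?thesis using False by simp
        qed
      qed
    qed (use L(2) in \<open>auto simp: measurable_cong_sets[OF L(2) refl]\<close>)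
    then show ?thesis using L(2) sets_eq_imp_space_eq[OF L(2)] by simp
  qed
  have "measure M {a<..} = measure N {a<..}" for a
  proof -
    have "(\<integral>t. max 0 (min 1 (real n * (t - a))) \<partial>M) = (\<integral>t. max 0 (min 1 (real n * (t - a))) \<partial>N)" for n :: nat
      by (intro cont continuous_intros)
    then show ?thesis using meas[OF fin(1) sets(1), of a] meas[OF fin(2) sets(2), of a] LIMSEQ_unique by simp
  qed
  then show ?thesis
    using fin sets
    by (intro measure_eqI_lessThan)
      (auto simp: finite_measure.emeasure_eq_measure finite_measure.emeasure_finite less_top[symmetric])
qed

section \<open>Bounded spectrum and moments\<close>

context pvm
begin

text \<open>Let \<open>y\<close> be the part of \<open>x\<close> with spectrum in
  \<open>\<bar>t\<bar> > K\<close>. Then \<open>\<parallel>B y\<parallel>\<^sup>2 - K\<^sup>2 *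
  \<parallel>y\<parallel>\<^sup>2\<close> is at most 0, yet it is the integral over
  \<open>mu y\<close> of a function that is positive almost everywhere; so \<open>mu y\<close>
  vanishes. The powers follow from the product rule.\<close>

lemma
  assumes B: "spectral_integral E (\<lambda>t. t) = graph_of B" and K: "\<And>x. norm (B x) \<le> K * norm x" "0 \<le> K"
  shows AE_bounded_spectrum: "AE t in mu x. \<bar>t\<bar> \<le> K"
    and spectral_integral_power: "(x, (B ^^ n) x) \<in> spectral_integral E (\<lambda>t. t ^ n)"
proof -
  have graph: "(x, B x) \<in> spectral_integral E (\<lambda>t. t)" for x
    unfolding B graph_of_def by blast
  have id: "(\<lambda>t::real. t) \<in> borel_measurable borel" by simp
  define M where "M = {t. K < \<bar>t\<bar>}"
  have M: "M \<in> sets borel" unfolding M_def by measurable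
  define y where "y = E M x"
  interpret finite_measure "mu y" by (rule finite_measure_mu)
  have AEM: "AE t in mu y. K < \<bar>t\<bar>"
    unfolding y_def mu_proj[OF M] using M by (subst AE_density) (auto simp: indicator_def M_def)
  have i2: "integrable (mu y) (\<lambda>t. t\<^sup>2)"
    using spectral_integral_domain[OF graph] by (auto simp: spectral_domain_def)
  have pos: "AE t in mu y. 0 < t\<^sup>2 - K\<^sup>2"
    using AEM
  proof eventually_elim
    case (elim t)
    then have "K\<^sup>2 < \<bar>t\<bar>\<^sup>2" using K(2) by (intro power_strict_mono) auto
    then show ?case by simp
  qed
  have nn: "AE t in mu y. 0 \<le> t\<^sup>2 - K\<^sup>2"
    using pos by eventually_elim simp
  have "(\<integral>t. t\<^sup>2 - K\<^sup>2 \<partial>mu y) = (norm (B y))\<^sup>2 - K\<^sup>2 * (norm y)\<^sup>2"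
    using i2 by (simp add: spectral_integral_norm[OF id graph] measure_mu mult.commute)
  also have "\<dots> \<le> 0"
    using power_mono[OF K(1)[of y] norm_ge_zero, of 2] by (simp add: power_mult_distrib)
  finally have "(\<integral>t. t\<^sup>2 - K\<^sup>2 \<partial>mu y) = 0"
    using integral_nonneg_AE[OF nn] by linarith
  then have "AE t in mu y. t\<^sup>2 - K\<^sup>2 = 0"
    using integral_nonneg_eq_0_iff_AE[OF _ nn] i2 by simp
  with pos have "AE t in mu y. False" by eventually_elim simp
  then have "emeasure (mu y) UNIV = 0" by (simp add: AE_iff_measurable[OF _ refl])
  then have "emeasure (mu x) M = 0" by (simp add: emeasure_mu y_def M)
  then show "AE t in mu x. \<bar>t\<bar> \<le> K"
    using M by (intro AE_I[of _ _ M]) (auto simp: M_def)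
  show "(x, (B ^^ n) x) \<in> spectral_integral E (\<lambda>t. t ^ n)"
  proof (induction n)
    case 0
    then show ?case using spectral_integral_one by simp
  next
    case (Suc n)
    have "(x, B ((B ^^ n) x)) \<in> spectral_integral E (\<lambda>t. t ^ n * t)"
      by (rule spectral_integral_compose[OF _ id Suc.IH graph]) simp
    then show ?case by (simp add: mult.commute)
  qed
qed

end

text \<open>The \<open>n\<close>-th moment of either measure is \<open>inner ((B ^^ n) x) x\<close>,
  which involves \<open>B\<close> alone, and both measures are carried by
  \<open>{-K..K}\<close>.\<close>

lemma scalar_measure_unique:
  fixes B :: "'a::{real_inner, complete_space} \<Rightarrow> 'a"
  assumes E: "spectral_measure_of (graph_of B) E" and F: "spectral_measure_of (graph_of B) F"
    and K: "\<And>x. norm (B x) \<le> K * norm x" "0 \<le> K"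
  shows "scalar_measure E x = scalar_measure F x"
proof -
  interpret E: pvm E using E by unfold_locales (simp add: spectral_measure_of_def)
  interpret F: pvm F using F by unfold_locales (simp add: spectral_measure_of_def)
  have BE: "spectral_integral E (\<lambda>t. t) = graph_of B" and BF: "spectral_integral F (\<lambda>t. t) = graph_of B"
    using E F by (auto simp: spectral_measure_of_def)
  show ?thesis
  proof (rule measure_eqI_moments[where K = K])
    fix n :: nat
    have m: "(\<lambda>t::real. t ^ n) \<in> borel_measurable borel" by simp
    show "(\<integral>t. t ^ n \<partial>E.mu x) = (\<integral>t. t ^ n \<partial>F.mu x)"
      using E.spectral_integral_inner[OF m E.spectral_integral_power[OF BE K]]
        F.spectral_integral_inner[OF m F.spectral_integral_power[OF BF K]] by simp
  qed (simp_all add: E.finite_measure_mu F.finite_measure_mu E.AE_bounded_spectrum[OF BE K]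
      F.AE_bounded_spectrum[OF BF K])
qed

section \<open>The inverse of a concave index function\<close>

text \<open>At \<open>l = \<Psi> m\<close> the value \<open>\<nu> l\<close> is the reciprocal of
  \<open>\<Psi> m / m\<close>. So monotonicity of \<open>\<nu>\<close> reflects that
  \<open>\<Psi> m / m\<close> decreases, and growth of \<open>\<nu>\<close> that
  \<open>\<Psi> m / m\<close> tends to 0 at infinity.\<close>

lemma
  fixes \<Psi> :: "real \<Rightarrow> real"
  assumes idx: "index_function \<Psi>" and conc: "concave_on {0<..} \<Psi>" and mono: "strict_mono_on {0<..} \<Psi>"
    and lim0: "(\<Psi> \<longlongrightarrow> 0) (at_right 0)" and top: "filterlim \<Psi> at_top at_top"
    and sub: "((\<lambda>l. \<Psi> l / l) \<longlongrightarrow> 0) at_top"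
  defines "\<nu> \<equiv> \<lambda>l. the_inv_into {0<..} \<Psi> l / l"
  shows index_function_inverse_ratio: "index_function \<nu>"
    and mono_inverse_ratio: "mono_on {0<..} \<nu>"
    and inverse_ratio_at_top: "filterlim \<nu> at_top at_top"
proof -
  define \<psi> where "\<psi> = the_inv_into {0<..} \<Psi>"
  have cont: "continuous_on {0<..} \<Psi>" and pos: "\<And>t. t > 0 \<Longrightarrow> \<Psi> t > 0"
    using idx by (auto simp: index_function_def)
  have less: "\<Psi> s < \<Psi> t" if "0 < s" "s < t" for s t
    using strict_mono_onD[OF mono] that by simp
  have inj: "inj_on \<Psi> {0<..}" using mono by (rule strict_mono_on_imp_inj_on)
  have surj: "\<exists>l>0. \<Psi> l = y" if "y > 0" for y
  proof -
    have "eventually (\<lambda>t. \<Psi> t < y) (at_right 0)" using order_tendstoD(2)[OF lim0 that] .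
    then obtain e where "e > 0" "\<And>t. 0 < t \<Longrightarrow> t < e \<Longrightarrow> \<Psi> t < y"
      by (auto simp: eventually_at_right_field)
    then have a: "0 < e / 2" "\<Psi> (e / 2) < y" by auto
    have "eventually (\<lambda>t. y \<le> \<Psi> t) at_top" using top by (simp add: filterlim_at_top)
    then obtain N where N: "\<And>t. t \<ge> N \<Longrightarrow> y \<le> \<Psi> t" by (auto simp: eventually_at_top_linorder)
    define b where "b = max N (e / 2)"
    have "\<exists>x\<ge>e/2. x \<le> b \<and> \<Psi> x = y"
    proof (rule IVT')
      show "continuous_on {e/2..b} \<Psi>"
        using cont by (rule continuous_on_subset) (use a in auto)
    qed (use a N in \<open>auto simp: b_def\<close>)
    then obtain x where "e / 2 \<le> x" "\<Psi> x = y" by blast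
    then show ?thesis using a(1) by (intro exI[of _ x]) linarith
  qed
  have \<psi>: "0 < \<psi> y" "\<Psi> (\<psi> y) = y" if y: "y > 0" for y
  proof -
    obtain l where l: "l > 0" "\<Psi> l = y" using surj[OF y] by blast
    have "\<psi> y = l" unfolding \<psi>_def using the_inv_into_f_f[OF inj, of l] l by simp
    then show "0 < \<psi> y" "\<Psi> (\<psi> y) = y" using l by simp_all
  qed
  have \<psi>\<Psi>: "\<psi> (\<Psi> l) = l" if "l > 0" for l
    unfolding \<psi>_def using the_inv_into_f_f[OF inj, of l] that by simp
  have \<psi>_mono: "\<psi> x \<le> \<psi> y" if "0 < x" "x \<le> y" for x y
  proof (rule ccontr)
    assume "\<not> \<psi> x \<le> \<psi> y"
    then have "\<Psi> (\<psi> y) < \<Psi> (\<psi> x)" using \<psi>[of y] that by (intro less) auto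
    then show False using \<psi>[of x] \<psi>[of y] that by simp
  qed
  \<comment> \<open>A monotone function whose image is open cannot jump.\<close>
  have cont_\<psi>: "continuous_on {0<..} \<psi>"
  proof (rule continuous_onI_mono)
    have "\<psi> ` {0<..} = {0<..}"
    proof
      show "\<psi> ` {0<..} \<subseteq> {0<..}" using \<psi>(1) by auto
      show "{0<..} \<subseteq> \<psi> ` {0<..}"
      proof
        fix l :: real assume "l \<in> {0<..}"
        then show "l \<in> \<psi> ` {0<..}" using \<psi>\<Psi>[of l] pos[of l] by (intro image_eqI[of _ _ "\<Psi> l"]) auto
      qed
    qed
    then show "open (\<psi> ` {0<..})" by simp
  qed (use \<psi>_mono in auto)
  have ratio: "s / t * \<Psi> t \<le> \<Psi> s" if st: "0 < s" "s < t" for s t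
  proof -
    \<comment> \<open>Concavity is assumed on \<open>{0<..}\<close> only, so the chord starts at a
      small \<open>e > 0\<close> instead of 0; the term with \<open>\<Psi> e > 0\<close> is dropped,
      and \<open>e\<close> then tends to 0.\<close>
    have "(s - e) / (t - e) * \<Psi> t \<le> \<Psi> s" if e: "0 < e" "e < s" for e
    proof -
      define u where "u = (s - e) / (t - e)"
      have u: "0 \<le> u" "u \<le> 1" unfolding u_def using st e by auto
      have "u * (t - e) = s - e" unfolding u_def using st e by simp
      then have "s = (1 - u) * e + u * t" by (simp add: algebra_simps)
      moreover have "(1 - u) * \<Psi> e + u * \<Psi> t \<le> \<Psi> ((1 - u) * e + u * t)"
        using concave_onD[OF conc u, of e t] st e by simp
      moreover have "0 \<le> (1 - u) * \<Psi> e" using u pos[OF e(1)] by simp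
      ultimately show ?thesis unfolding u_def by simp
    qed
    then have "eventually (\<lambda>e. (s - e) / (t - e) * \<Psi> t \<le> \<Psi> s) (at_right 0)"
      using st by (auto simp: eventually_at_right_field)
    moreover have "((\<lambda>e. (s - e) / (t - e) * \<Psi> t) \<longlongrightarrow> (s - 0) / (t - 0) * \<Psi> t) (at_right 0)"
      using st by (intro tendsto_intros) auto
    ultimately show ?thesis
      using tendsto_upperbound[of "\<lambda>e. (s - e) / (t - e) * \<Psi> t"] by simp
  qed
  have \<nu>: "\<nu> l = \<psi> l / l" for l unfolding \<nu>_def \<psi>_def ..
  show "index_function \<nu>"
    unfolding index_function_def \<nu> using \<psi>(1) cont_\<psi> by (auto intro!: continuous_intros)
  show "mono_on {0<..} \<nu>"
  proof (rule mono_onI)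
    fix x y :: real assume "x \<in> {0<..}" "y \<in> {0<..}" "x \<le> y"
    then have xy: "0 < x" "0 < y" "x \<le> y" by auto
    show "\<nu> x \<le> \<nu> y"
    proof (cases "\<psi> x = \<psi> y")
      case True
      then have "x = y" using \<psi>(2)[OF xy(1)] \<psi>(2)[OF xy(2)] by metis
      then show ?thesis by simp
    next
      case False
      then have "\<psi> x < \<psi> y" using \<psi>_mono xy by fastforce
      then have "\<psi> x / \<psi> y * \<Psi> (\<psi> y) \<le> \<Psi> (\<psi> x)" using \<psi>[of x] xy by (intro ratio) auto
      then show ?thesis using \<psi>[of x] \<psi>[of y] xy unfolding \<nu> by (simp add: field_simps)
    qed
  qed
  show "filterlim \<nu> at_top at_top"
    unfolding filterlim_at_top_gt[of _ _ "0::real"]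
  proof (intro allI impI)
    fix Z :: real assume "0 < Z"
    then have "eventually (\<lambda>l. \<Psi> l / l < 1 / Z) at_top" using order_tendstoD(2)[OF sub, of "1 / Z"] by simp
    then obtain N where N: "\<And>l. l \<ge> N \<Longrightarrow> \<Psi> l / l < 1 / Z" by (auto simp: eventually_at_top_linorder)
    \<comment> \<open>The maximum with 1 makes \<open>L\<close> positive, so that
      \<open>\<psi> (\<Psi> L) = L\<close> is available.\<close>
    define L where "L = max N 1"
    have "Z \<le> \<nu> y" if y: "y \<ge> \<Psi> L" for y
    proof -
      have L: "L > 0" unfolding L_def by simp
      have y0: "0 < y" using pos[OF L] y by linarith
      have "L \<le> \<psi> y" using \<psi>_mono[OF pos[OF L] y] \<psi>\<Psi>[OF L] by simp
      then have "\<Psi> (\<psi> y) / \<psi> y < 1 / Z" unfolding L_def by (intro N) simp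
      then have "y / \<psi> y < 1 / Z" using \<psi>(2)[OF y0] by simp
      then show ?thesis using \<psi>(1)[OF y0] y0 \<open>0 < Z\<close> unfolding \<nu> by (simp add: field_simps)
    qed
    then show "eventually (\<lambda>y. Z \<le> \<nu> y) at_top" by (auto simp: eventually_at_top_linorder)
  qed
qed

text \<open>The substitution \<open>1 / t\<close> and the outer reciprocal each reverse the order,
  so \<open>g\<close> increases with \<open>\<nu>\<close>; the limit 0 of \<open>g\<close> at 0 is
  the growth of \<open>\<nu>\<close> at infinity.\<close>

lemma rate_function_inverse_sqrt:
  fixes \<nu> g :: "real \<Rightarrow> real"
  assumes idx: "index_function \<nu>" and mono: "mono_on {0<..} \<nu>" and top: "filterlim \<nu> at_top at_top"
    and g: "\<And>t. t > 0 \<Longrightarrow> g t = 1 / sqrt (\<nu> (1 / t))"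
  shows "rate_function g"
proof -
  have cont: "continuous_on {0<..} \<nu>" and pos: "\<And>t. t > 0 \<Longrightarrow> \<nu> t > 0"
    using idx by (auto simp: index_function_def)
  have "continuous_on {0<..} (\<lambda>t. \<nu> (1 / t))"
    by (rule continuous_on_compose2[OF cont]) (auto intro!: continuous_intros)
  then have "continuous_on {0<..} (\<lambda>t. 1 / sqrt (\<nu> (1 / t)))"
    using pos[of "1 / t" for t] by (intro continuous_intros) (auto simp: less_imp_neq[symmetric] order_less_imp_not_eq2)
  then have c: "continuous_on {0<..} g" by (rule continuous_on_eq) (simp add: g)
  have p: "g t > 0" if "t > 0" for t using that pos[of "1 / t"] by (simp add: g)
  have m: "mono_on {0<..} g"
  proof (rule mono_onI)
    fix x y :: real assume "x \<in> {0<..}" "y \<in> {0<..}" "x \<le> y"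
    then have xy: "0 < x" "0 < y" "x \<le> y" by auto
    then have "\<nu> (1 / y) \<le> \<nu> (1 / x)" by (intro mono_onD[OF mono]) (auto simp: frac_le)
    then show "g x \<le> g y" using xy pos[of "1 / y"] by (simp add: g frac_le)
  qed
  have "filterlim (\<lambda>t. \<nu> (inverse t)) at_top (at_right 0)"
    by (rule filterlim_compose[OF top filterlim_inverse_at_top_right])
  then have "((\<lambda>t. inverse (sqrt (\<nu> (inverse t)))) \<longlongrightarrow> 0) (at_right 0)"
    by (intro tendsto_inverse_0_at_top filterlim_compose[OF sqrt_at_top])
  moreover have "eventually (\<lambda>t. inverse (sqrt (\<nu> (inverse t))) = g t) (at_right 0)"
    by (intro eventually_mono[OF eventually_at_right_less[of "0::real"]]) (simp add: g inverse_eq_divide)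
  ultimately have "(g \<longlongrightarrow> 0) (at_right 0)" by (rule Lim_transform_eventually)
  then show ?thesis using c p m by (simp add: rate_function_def index_function_def)
qed

section \<open>Spectral calculus of an operator and of its inverse\<close>

lemma spectral_integral_cong_scalar:
  assumes "\<And>x. scalar_measure E x = scalar_measure F x"
  shows "spectral_integral E g = spectral_integral F g"
  unfolding spectral_integral_def spectral_domain_def assms ..

lemma pvm_spectral_measure: "spectral_measure_of S E \<Longrightarrow> pvm E"
  by unfold_locales (simp add: spectral_measure_of_def)

text \<open>Two uses of \<open>spectral_integral_inverse\<close> identify the integral of
  \<open>1 / t\<close> with the converse of \<open>S\<close>. Since \<open>inverse 0 = 0\<close>,
  the point 0 has to be a null set.\<close>

lemma spectral_measure_image_inverse:
  fixes S :: "'a::{real_inner, complete_space} operator"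
  assumes S: "spectral_measure_of S E" and nz: "\<And>x. AE t in scalar_measure E x. t \<noteq> 0"
  shows "spectral_measure_of (S\<inverse>) (\<lambda>M. E (inverse -` M))"
proof -
  interpret pvm E using S by (rule pvm_spectral_measure)
  have si: "spectral_integral E (\<lambda>t. t) = S" using S by (simp add: spectral_measure_of_def)
  have 1: "AE t in mu x. t * inverse t = 1" and 2: "AE t in mu x. inverse t * t = 1" for x
    using nz[of x] by (auto elim!: eventually_mono)
  have m: "(\<lambda>t::real. t) \<in> borel_measurable borel" "inverse \<in> borel_measurable (borel :: real measure)"
    by simp_all
  have "(x, y) \<in> spectral_integral E inverse \<longleftrightarrow> (y, x) \<in> S" for x y
    unfolding si[symmetric]
    using spectral_integral_inverse[OF m 1] spectral_integral_inverse[OF m(2,1) 2] by blast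
  then have "spectral_integral E inverse = S\<inverse>" by (auto simp del: split_paired_All)
  then show ?thesis
    using projection_valued_measure_image[OF m(2)] spectral_integral_image[OF m(2,1)]
    unfolding spectral_measure_of_def by (metis (no_types))
qed

definition zero_extension :: "(real \<Rightarrow> real) \<Rightarrow> real \<Rightarrow> real" where
  "zero_extension g = (\<lambda>t. if 0 < t then g t else 0)"

text \<open>\<open>B\<close> plays the role of \<open>A\<^sup>* A\<close>, so that
  \<open>inv_op\<close> is \<open>T\<close>.\<close>

locale positive_injective_operator =
  fixes B :: "'a::{real_inner, complete_space} \<Rightarrow> 'a" and K :: real
  assumes K: "0 < K" "norm (B x) \<le> K * norm x"
    and nonneg: "0 \<le> inner (B x) x"
    and injective: "B x = 0 \<Longrightarrow> x = 0"
begin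

abbreviation inv_op :: "'a operator" where "inv_op \<equiv> (graph_of B)\<inverse>"

lemma B_zero: "B 0 = 0"
  using K(2)[of 0] by simp

lemma graph_of_iff: "(x, y) \<in> graph_of B \<longleftrightarrow> y = B x"
  by (auto simp: graph_of_def)

text \<open>For \<open>y\<close> in the range of \<open>E {- real n..0}\<close> and
  \<open>z = T y\<close>, positivity of \<open>B\<close> gives
  \<open>inner z y = inner z (B z) \<ge> 0\<close>, while the spectral integral for
  \<open>inner z y\<close> is at most 0. So \<open>t = 0\<close> almost everywhere for
  \<open>mu y\<close>, whence \<open>z = 0\<close> and \<open>y = B z = 0\<close>.\<close>

lemma AE_inv_op_pos:
  assumes E: "spectral_measure_of inv_op E"
  shows "AE t in scalar_measure E x. 0 < t"
proof -
  interpret pvm E using E by (rule pvm_spectral_measure)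
  have si: "spectral_integral E (\<lambda>t. t) = inv_op" using E by (simp add: spectral_measure_of_def)
  have id: "(\<lambda>t::real. t) \<in> borel_measurable borel" by simp
  have zero: "E {- real n..0} x = 0" for n
  proof -
    define y where "y = E {- real n..0} x"
    have y: "y \<in> spectral_domain E (\<lambda>t. t)"
      unfolding y_def by (rule spectral_domain_proj_bounded[of _ _ "real n"]) auto
    obtain z where z: "(y, z) \<in> spectral_integral E (\<lambda>t. t)" using spectral_integral_total[OF id y] by blast
    then have yz: "y = B z" by (simp add: si graph_of_iff)
    have np: "AE t in mu y. 0 \<le> - t"
      unfolding y_def by (subst mu_proj, simp, subst AE_density) (auto simp: indicator_def)
    have int: "integrable (mu y) (\<lambda>t. - t)" using integrable_spectral_domain[OF id y] by simp
    have "0 \<le> inner z y" using nonneg[of z] by (simp add: yz inner_commute)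
    then have "(\<integral>t. - t \<partial>mu y) \<le> 0" using spectral_integral_inner[OF id z] by simp
    then have "(\<integral>t. - t \<partial>mu y) = 0" using integral_nonneg_AE[OF np] by linarith
    then have "AE t in mu y. - t = 0" using integral_nonneg_eq_0_iff_AE[OF int np] by simp
    then have "(\<integral>t. t\<^sup>2 \<partial>mu y) = (\<integral>t. 0 \<partial>mu y)" by (intro integral_cong_AE) (auto elim!: eventually_mono)
    then have "z = 0" using spectral_integral_norm[OF id z] by simp
    then show ?thesis using yz B_zero y_def by simp
  qed
  \<comment> \<open>The bounded intervals, needed above to have \<open>y\<close> in the domain of
    \<open>T\<close>, exhaust the half-line.\<close>
  have "(\<lambda>n. E {t. \<bar>t\<bar> \<le> real n} (E {..0} x)) \<longlonglongrightarrow> E {..0} x"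
    by (rule proj_sublevel(2)[OF id])
  moreover have "E {t. \<bar>t\<bar> \<le> real n} (E {..0} x) = 0" for n
  proof -
    have "{t. \<bar>t\<bar> \<le> real n} \<inter> {..0} = {- real n..0}" by auto
    then show ?thesis using zero[of n] by (simp add: proj_Int[OF proj_sublevel(1)[OF id]])
  qed
  ultimately have "E {..0} x = 0" by (simp add: LIMSEQ_const_iff)
  then show ?thesis by (intro AE_I[of _ _ "{..0}"]) (auto simp: emeasure_mu)
qed

text \<open>The range of \<open>F {0}\<close> is annihilated by \<open>B\<close>, which is
  injective.\<close>

lemma AE_graph_nonzero:
  assumes F: "spectral_measure_of (graph_of B) F"
  shows "AE t in scalar_measure F x. t \<noteq> 0"
proof -
  interpret pvm F using F by (rule pvm_spectral_measure)
  have si: "spectral_integral F (\<lambda>t. t) = graph_of B" using F by (simp add: spectral_measure_of_def)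
  have id: "(\<lambda>t::real. t) \<in> borel_measurable borel" by simp
  define y where "y = F {0} x"
  have By: "(y, B y) \<in> spectral_integral F (\<lambda>t. t)" by (simp add: si graph_of_iff)
  have "AE t in mu y. t = 0"
    unfolding y_def by (subst mu_proj, simp, subst AE_density) (auto simp: indicator_def)
  then have "(\<integral>t. t\<^sup>2 \<partial>mu y) = (\<integral>t. 0 \<partial>mu y)" by (intro integral_cong_AE) (auto elim!: eventually_mono)
  then have "B y = 0" using spectral_integral_norm[OF id By] by simp
  then have "F {0} x = 0" using injective y_def by simp
  then show ?thesis by (intro AE_I[of _ _ "{0}"]) (auto simp: emeasure_mu)
qed

lemma spectral_measure_graph:
  assumes E: "spectral_measure_of inv_op E"
  shows "spectral_measure_of (graph_of B) (\<lambda>M. E (inverse -` M))"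
proof -
  have "AE t in scalar_measure E x. t \<noteq> 0" for x
    using AE_inv_op_pos[OF E, of x] by (auto elim!: eventually_mono)
  then show ?thesis using spectral_measure_image_inverse[OF E] by simp
qed

lemma spectral_measure_inv_op:
  "spectral_measure_of (graph_of B) F \<Longrightarrow> spectral_measure_of inv_op (\<lambda>M. F (inverse -` M))"
  by (rule spectral_measure_image_inverse[OF _ AE_graph_nonzero])

text \<open>The spectrum of \<open>B\<close> is bounded by \<open>K\<close>; pulled back along
  \<open>inverse\<close>, and with positivity, this becomes \<open>t \<ge> 1 / K\<close>.\<close>

lemma AE_inv_op_lower_bound:
  assumes E: "spectral_measure_of inv_op E"
  shows "AE t in scalar_measure E x. 1 / K \<le> t"
proof -
  interpret pvm E using E by (rule pvm_spectral_measure)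
  let ?F = "\<lambda>M. E (inverse -` M)"
  have F: "spectral_measure_of (graph_of B) ?F" by (rule spectral_measure_graph[OF E])
  interpret F: pvm ?F using F by (rule pvm_spectral_measure)
  have "AE t in F.mu x. \<bar>t\<bar> \<le> K"
    using F K by (intro F.AE_bounded_spectrum) (auto simp: spectral_measure_of_def)
  moreover have m: "inverse \<in> borel_measurable (borel :: real measure)" by simp
  ultimately have "AE t in distr (mu x) borel inverse. \<bar>t\<bar> \<le> K"
    by (simp only: scalar_measure_image[OF m])
  then have "AE t in mu x. \<bar>inverse t\<bar> \<le> K"
    by (subst (asm) AE_distr_iff) auto
  with AE_inv_op_pos[OF E, of x] show ?thesis
    by eventually_elim (use K(1) in \<open>simp add: field_simps\<close>)
qed

text \<open>Uniqueness is transported from the bounded operator \<open>B\<close>: the images under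
  \<open>inverse\<close> are spectral measures of \<open>B\<close>, and \<open>inverse\<close> is an
  involution, so a second image recovers the original measures.\<close>

lemma scalar_measure_inv_op_unique:
  assumes E: "spectral_measure_of inv_op E" and F: "spectral_measure_of inv_op F"
  shows "scalar_measure E x = scalar_measure F x"
proof -
  interpret E: pvm E using E by (rule pvm_spectral_measure)
  interpret F: pvm F using F by (rule pvm_spectral_measure)
  have "scalar_measure (\<lambda>M. E (inverse -` M)) x = scalar_measure (\<lambda>M. F (inverse -` M)) x"
    by (rule scalar_measure_unique[OF spectral_measure_graph[OF E] spectral_measure_graph[OF F] K(2)])
      (use K(1) in simp)
  then have eq: "distr (E.mu x) borel inverse = distr (F.mu x) borel inverse"
    by (simp add: E.scalar_measure_image F.scalar_measure_image)
  have "distr (distr M borel inverse) borel inverse = M" if "sets M = sets borel" for M :: "real measure"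
    using that measurable_cong_sets[OF that refl, of "borel :: real measure"]
    by (subst distr_distr) (simp_all add: o_def distr_id2)
  from this[of "E.mu x"] this[of "F.mu x"] show ?thesis unfolding eq by simp
qed

text \<open>All spectral measures of \<open>inv_op\<close> share their scalar measures, on which
  alone \<open>spectral_integral\<close> depends; so the quantifier in \<open>fun_of_op\<close> can
  be resolved by any one of them.\<close>

lemma fun_of_op_inv_op:
  assumes E: "spectral_measure_of inv_op E"
  shows "fun_of_op g inv_op = spectral_integral E (zero_extension g)"
proof -
  have "spectral_integral F h = spectral_integral E h" if "spectral_measure_of inv_op F" for F h
    by (intro spectral_integral_cong_scalar scalar_measure_inv_op_unique that E)
  then show ?thesis
    unfolding fun_of_op_def zero_extension_def[symmetric] using E by blast
qed

lemma fun_of_op_graph: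
  assumes E: "spectral_measure_of inv_op E" and g: "zero_extension g \<in> borel_measurable borel"
  shows "fun_of_op g (graph_of B) = spectral_integral E (\<lambda>t. zero_extension g (inverse t))"
proof -
  interpret pvm E using E by (rule pvm_spectral_measure)
  let ?F = "\<lambda>M. E (inverse -` M)"
  note F = spectral_measure_graph[OF E]
  have "spectral_integral G h = spectral_integral ?F h" if "spectral_measure_of (graph_of B) G" for G h
    using K by (intro spectral_integral_cong_scalar scalar_measure_unique[OF that F, of K]) auto
  then have "fun_of_op g (graph_of B) = spectral_integral ?F (zero_extension g)"
    unfolding fun_of_op_def zero_extension_def[symmetric] using F by blast
  then show ?thesis using spectral_integral_image[of inverse "zero_extension g"] g by simp
qed

end

section \<open>Variable Hilbert scales generated by the inverse operator\<close>

lemma borel_measurable_index_function: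
  assumes "index_function g"
  shows "(\<lambda>t::real. if 0 < t then g t else 0) \<in> borel_measurable borel"
proof -
  have "(\<lambda>t. if t \<in> {0<..} then g t else 0) \<in> borel_measurable borel"
    using assms by (intro borel_measurable_continuous_on_if) (auto simp: index_function_def)
  then show ?thesis by simp
qed

locale variable_scale = positive_injective_operator B K + pvm E
  for B :: "'a::{real_inner, complete_space} \<Rightarrow> 'a" and K :: real
    and E :: "real set \<Rightarrow> 'a \<Rightarrow> 'a" +
  fixes \<nu> :: "real \<Rightarrow> real"
  assumes E: "spectral_measure_of inv_op E"
    and index: "index_function \<nu>" and mono: "mono_on {0<..} \<nu>"
begin

text \<open>The symbol of the square root of \<open>\<nu>(T)\<close>, whose domain is the form
  domain.\<close>

abbreviation \<rho> :: "real \<Rightarrow> real" where "\<rho> \<equiv> \<lambda>t. sqrt (zero_extension \<nu> t)"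

text \<open>The value \<open>1 / 0 = 0\<close> makes this function vanish on \<open>{..0}\<close>.\<close>

abbreviation \<kappa> :: "real \<Rightarrow> real" where "\<kappa> \<equiv> \<lambda>t. 1 / \<rho> t"

lemma zero_extension_measurable [measurable]: "zero_extension \<nu> \<in> borel_measurable borel"
  using borel_measurable_index_function[OF index] by (simp add: zero_extension_def)

lemma \<rho>_measurable: "\<rho> \<in> borel_measurable borel"
  by measurable

lemma \<kappa>_measurable: "\<kappa> \<in> borel_measurable borel"
  by measurable

lemma zero_extension_nonneg: "0 \<le> zero_extension \<nu> t"
  using index by (auto simp: zero_extension_def index_function_def less_imp_le)

lemma zero_extension_pos: "0 < t \<Longrightarrow> 0 < zero_extension \<nu> t"
  using index by (auto simp: zero_extension_def index_function_def)

lemma AE_\<rho>_\<kappa>: "AE t in mu x. \<rho> t * \<kappa> t = 1" "AE t in mu x. \<kappa> t * \<rho> t = 1"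
  using AE_inv_op_pos[OF E, of x] zero_extension_pos by (force elim!: eventually_mono)+

text \<open>The symbols multiply to 1 almost everywhere. This moves questions about the possibly
  unbounded \<open>\<rho>(T)\<close> to its bounded inverse.\<close>

lemma \<rho>_iff_\<kappa>: "(x, y) \<in> spectral_integral E \<rho> \<longleftrightarrow> (y, x) \<in> spectral_integral E \<kappa>"
  using spectral_integral_inverse[OF \<rho>_measurable \<kappa>_measurable AE_\<rho>_\<kappa>(1)]
    spectral_integral_inverse[OF \<kappa>_measurable \<rho>_measurable AE_\<rho>_\<kappa>(2)] by blast

text \<open>The value of \<open>\<kappa>\<close> at the spectral bound \<open>1 / K\<close>, hence
  its maximum on \<open>[1 / K, \<infinity>)\<close> because \<open>\<nu>\<close> is
  monotone.\<close>

definition \<kappa>_bound :: real where "\<kappa>_bound = 1 / sqrt (\<nu> (1 / K))"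

lemma AE_\<kappa>_le: "AE t in mu x. \<bar>\<kappa> t\<bar> \<le> \<kappa>_bound"
  using AE_inv_op_lower_bound[OF E, of x]
proof eventually_elim
  case (elim t)
  have k: "0 < 1 / K" using K(1) by simp
  then have t: "0 < t" using elim by linarith
  have "0 < \<nu> (1 / K)" using index k by (simp add: index_function_def)
  moreover have "\<nu> (1 / K) \<le> \<nu> t" using mono_onD[OF mono, of "1 / K" t] k t elim by simp
  ultimately show ?case using t by (simp add: \<kappa>_bound_def zero_extension_def frac_le)
qed

lemma \<kappa>_bound_nonneg: "0 \<le> \<kappa>_bound"
  using index K(1) by (simp add: \<kappa>_bound_def index_function_def less_imp_le)

lemma norm_\<kappa>:
  assumes "(v, h) \<in> spectral_integral E \<kappa>"
  shows "norm h \<le> \<kappa>_bound * norm v"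
proof -
  interpret finite_measure "mu v" by (rule finite_measure_mu)
  have "(norm h)\<^sup>2 = (\<integral>t. (\<kappa> t)\<^sup>2 \<partial>mu v)" by (rule spectral_integral_norm[OF \<kappa>_measurable assms])
  also have "\<dots> \<le> (\<integral>t. \<kappa>_bound\<^sup>2 \<partial>mu v)"
  proof (rule integral_mono_AE)
    show "integrable (mu v) (\<lambda>t. (\<kappa> t)\<^sup>2)"
      using spectral_integral_domain[OF assms] by (simp only: spectral_domain_def mem_Collect_eq)
    show "AE t in mu v. (\<kappa> t)\<^sup>2 \<le> \<kappa>_bound\<^sup>2"
      using AE_\<kappa>_le[of v]
    proof eventually_elim
      case (elim t)
      then show ?case using power_mono[OF elim, of 2] by (simp only: power2_abs)
    qed
  qed simp
  also have "\<dots> = (\<kappa>_bound * norm v)\<^sup>2" by (simp add: measure_mu power_mult_distrib mult.commute)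
  finally show ?thesis by (rule power2_le_imp_le) (simp add: \<kappa>_bound_nonneg)
qed

section \<open>The scale norm and the completion\<close>

lemma Domain_fun_of_op: "Domain (fun_of_op \<nu> inv_op) = spectral_domain E (zero_extension \<nu>)"
  unfolding fun_of_op_inv_op[OF E]
  using spectral_integral_total[OF zero_extension_measurable] spectral_integral_domain by blast

text \<open>Both squared norms equal the integral of \<open>\<nu>\<close> over \<open>mu h\<close>.
  That integral is finite since \<open>\<nu>\<close> is square integrable for the finite measure
  \<open>mu h\<close>.\<close>

lemma scale_norm_eq:
  assumes h: "h \<in> spectral_domain E (zero_extension \<nu>)"
  shows "\<exists>v. (h, v) \<in> spectral_integral E \<rho>"
    and "(h, v) \<in> spectral_integral E \<rho> \<Longrightarrow> scale_norm inv_op \<nu> h = norm v"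
proof -
  have "integrable (mu h) (\<lambda>t. (\<rho> t)\<^sup>2)"
    using integrable_spectral_domain[OF zero_extension_measurable h] by (simp add: zero_extension_nonneg)
  then show "\<exists>v. (h, v) \<in> spectral_integral E \<rho>"
    by (intro spectral_integral_total \<rho>_measurable) (simp only: spectral_domain_def mem_Collect_eq)
  assume v: "(h, v) \<in> spectral_integral E \<rho>"
  obtain y where y: "(h, y) \<in> spectral_integral E (zero_extension \<nu>)"
    using spectral_integral_total[OF zero_extension_measurable h] by blast
  then have "op_apply (fun_of_op \<nu> inv_op) h = y"
    unfolding op_apply_def fun_of_op_inv_op[OF E]
    using spectral_integral_unique[OF zero_extension_measurable] by (intro the_equality) auto
  then have "scale_norm inv_op \<nu> h = sqrt (\<integral>t. zero_extension \<nu> t \<partial>mu h)"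
    using spectral_integral_inner[OF zero_extension_measurable y] by (simp add: scale_norm_def inner_commute)
  also have "\<dots> = sqrt ((norm v)\<^sup>2)"
    using spectral_integral_norm[OF \<rho>_measurable v] by (simp add: zero_extension_nonneg)
  finally show "scale_norm inv_op \<nu> h = norm v" by simp
qed

lemma norm_le_scale_norm:
  assumes "h \<in> spectral_domain E (zero_extension \<nu>)"
  shows "norm h \<le> \<kappa>_bound * scale_norm inv_op \<nu> h"
  using scale_norm_eq[OF assms] norm_\<kappa> \<rho>_iff_\<kappa> by metis

lemma scale_norm_diff:
  assumes "h \<in> spectral_domain E (zero_extension \<nu>)" "k \<in> spectral_domain E (zero_extension \<nu>)"
    and "(h, v) \<in> spectral_integral E \<rho>" "(k, w) \<in> spectral_integral E \<rho>"
  shows "scale_norm inv_op \<nu> (h - k) = norm (v - w)"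
  by (intro scale_norm_eq(2) spectral_domain_add_diff spectral_integral_diff assms
      zero_extension_measurable \<rho>_measurable)

text \<open>\<open>\<rho>(T)\<close> maps the domain of \<open>\<nu>(T)\<close> isometrically from
  the scale norm into \<open>X\<close>.\<close>

lemma scale_Cauchy_iff:
  assumes "\<And>n. (h n, v n) \<in> spectral_integral E \<rho>"
  shows "h \<in> scale_Cauchy inv_op \<nu> \<longleftrightarrow> (\<forall>n. h n \<in> spectral_domain E (zero_extension \<nu>)) \<and> Cauchy v"
  unfolding scale_Cauchy_def Domain_fun_of_op mem_Collect_eq Cauchy_iff
  using scale_norm_diff[OF _ _ assms assms] by auto

lemma scale_Cauchy_domain: "h \<in> scale_Cauchy inv_op \<nu> \<Longrightarrow> h n \<in> spectral_domain E (zero_extension \<nu>)"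
  by (simp add: scale_Cauchy_def Domain_fun_of_op)

text \<open>The images under \<open>\<rho>(T)\<close> converge to some \<open>u\<close> because
  \<open>X\<close> is complete; applying the bounded operator \<open>\<kappa>(T)\<close> brings the
  convergence back to \<open>h\<close>, with limit \<open>\<kappa>(T) u\<close>.\<close>

lemma scale_Cauchy_limit:
  assumes h: "h \<in> scale_Cauchy inv_op \<nu>"
  shows "\<exists>f v. h \<longlonglongrightarrow> f \<and> (f, v) \<in> spectral_integral E \<rho>"
proof -
  obtain v where v: "\<And>n. (h n, v n) \<in> spectral_integral E \<rho>"
    using scale_norm_eq(1)[OF scale_Cauchy_domain[OF h]] by metis
  then have "Cauchy v" using h scale_Cauchy_iff by blast
  then obtain u where u: "v \<longlonglongrightarrow> u" using Cauchy_convergent_iff convergent_def by blast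
  have "u \<in> spectral_domain E \<kappa>" by (rule spectral_domain_AE_bounded[OF \<kappa>_measurable AE_\<kappa>_le])
  then obtain f where f: "(u, f) \<in> spectral_integral E \<kappa>"
    using spectral_integral_total[OF \<kappa>_measurable] by blast
  have "norm (h n - f) \<le> \<kappa>_bound * norm (v n - u)" for n
    using v f by (intro norm_\<kappa> spectral_integral_diff \<kappa>_measurable) (auto simp: \<rho>_iff_\<kappa>)
  moreover have "(\<lambda>n. \<kappa>_bound * norm (v n - u)) \<longlonglongrightarrow> \<kappa>_bound * norm (u - u)"
    by (intro tendsto_intros u)
  ultimately have "(\<lambda>n. norm (h n - f)) \<longlonglongrightarrow> 0"
    by (intro tendsto_sandwich[of "\<lambda>_. 0" "\<lambda>n. norm (h n - f)" _ "\<lambda>n. \<kappa>_bound * norm (v n - u)" 0]) auto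
  then have "h \<longlonglongrightarrow> f" by (simp add: LIM_zero_iff tendsto_norm_zero_iff)
  then show ?thesis using f \<rho>_iff_\<kappa> by blast
qed

lemma scale_equiv_refl:
  assumes "h \<in> scale_Cauchy inv_op \<nu>"
  shows "(h, h) \<in> scale_equiv inv_op \<nu>"
  using assms by (simp add: scale_equiv_def scale_norm_def)

lemma scale_equiv_diff_tendsto:
  assumes "(h, k) \<in> scale_equiv inv_op \<nu>"
  shows "(\<lambda>n. h n - k n) \<longlonglongrightarrow> 0"
proof -
  have hk: "h \<in> scale_Cauchy inv_op \<nu>" "k \<in> scale_Cauchy inv_op \<nu>"
    and lim: "(\<lambda>n. scale_norm inv_op \<nu> (h n - k n)) \<longlonglongrightarrow> 0"
    using assms by (auto simp: scale_equiv_def)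
  have "norm (h n - k n) \<le> \<kappa>_bound * scale_norm inv_op \<nu> (h n - k n)" for n
    by (intro norm_le_scale_norm spectral_domain_add_diff scale_Cauchy_domain hk zero_extension_measurable)
  moreover have "(\<lambda>n. \<kappa>_bound * scale_norm inv_op \<nu> (h n - k n)) \<longlonglongrightarrow> \<kappa>_bound * 0"
    by (intro tendsto_intros lim)
  ultimately show ?thesis
    by (intro Lim_null_comparison[of "\<lambda>n. h n - k n" "\<lambda>n. \<kappa>_bound * scale_norm inv_op \<nu> (h n - k n)"]) auto
qed

text \<open>Cauchy sequences of the scale converge in \<open>X\<close>, and equivalent ones differ
  by a null sequence of \<open>X\<close>, because the scale norm dominates the norm. So each class
  has exactly one limit vector.\<close>

lemma represents_unique:
  assumes F: "F \<in> scale_space inv_op \<nu>"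
  shows "\<exists>!f. represents F f"
proof -
  obtain k where k: "k \<in> scale_Cauchy inv_op \<nu>" "F = scale_equiv inv_op \<nu> `` {k}"
    using F by (auto simp: scale_space_def quotient_def)
  obtain f where f: "k \<longlonglongrightarrow> f" using scale_Cauchy_limit[OF k(1)] by blast
  have "represents F f"
    using f scale_equiv_refl[OF k(1)] by (auto simp: represents_def k(2))
  moreover have "g = f" if rep: "represents F g" for g
  proof -
    obtain h where h: "(k, h) \<in> scale_equiv inv_op \<nu>" "h \<longlonglongrightarrow> g"
      using rep by (auto simp: represents_def k(2))
    have "(\<lambda>n. k n - h n) \<longlonglongrightarrow> f - g" by (intro tendsto_intros f h)
    then show ?thesis using scale_equiv_diff_tendsto[OF h(1)] LIMSEQ_unique by fastforce
  qed
  ultimately show ?thesis by blast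
qed

text \<open>Limits of Cauchy sequences of the scale lie in the domain of \<open>\<rho>(T)\<close>;
  conversely, spectral cut-offs of a vector in that domain form such a sequence.\<close>

lemma in_scale_space_iff:
  "in_scale_space f inv_op \<nu> \<longleftrightarrow> (\<exists>v. (f, v) \<in> spectral_integral E \<rho>)"
proof
  assume "in_scale_space f inv_op \<nu>"
  then obtain h where h: "h \<in> scale_Cauchy inv_op \<nu>" "h \<longlonglongrightarrow> f"
    by (auto simp: in_scale_space_def represents_def scale_space_def quotient_def scale_equiv_def)
  then show "\<exists>v. (f, v) \<in> spectral_integral E \<rho>" using scale_Cauchy_limit LIMSEQ_unique by metis
next
  assume "\<exists>v. (f, v) \<in> spectral_integral E \<rho>"
  then obtain v where v: "(f, v) \<in> spectral_integral E \<rho>" by blast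
  \<comment> \<open>Where \<open>\<nu>\<close> is bounded, \<open>P n f\<close> lies in the domain
    of \<open>\<nu>(T)\<close>. The projections commute with \<open>\<rho>(T)\<close>, so the images
    \<open>P n v\<close> converge to \<open>v\<close> and are Cauchy.\<close>
  define P where "P n = E {t. \<bar>zero_extension \<nu> t\<bar> \<le> real n}" for n
  have P: "(P n f, P n v) \<in> spectral_integral E \<rho>" for n
    unfolding P_def by (intro spectral_integral_proj proj_sublevel(1) zero_extension_measurable \<rho>_measurable v)
  have "P n f \<in> spectral_domain E (zero_extension \<nu>)" for n
    unfolding P_def by (intro proj_sublevel(3) zero_extension_measurable)
  moreover have lim: "(\<lambda>n. P n x) \<longlonglongrightarrow> x" for x
    unfolding P_def by (intro proj_sublevel(2) zero_extension_measurable)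
  ultimately have c: "(\<lambda>n. P n f) \<in> scale_Cauchy inv_op \<nu>"
    using scale_Cauchy_iff[of "\<lambda>n. P n f" "\<lambda>n. P n v", OF P] LIMSEQ_imp_Cauchy by blast
  then have "scale_equiv inv_op \<nu> `` {\<lambda>n. P n f} \<in> scale_space inv_op \<nu>"
    by (auto simp: scale_space_def intro: quotientI)
  then show "in_scale_space f inv_op \<nu>"
    unfolding in_scale_space_def represents_def using scale_equiv_refl[OF c] lim[of f] by blast
qed

text \<open>In the spectral variable of \<open>T\<close>, the operator \<open>g(A\<^sup>* A)\<close>
  has symbol \<open>\<kappa>\<close>, so the source element of \<open>f\<close> is
  \<open>\<rho>(T) f\<close>.\<close>

lemma in_scale_space_iff_source:
  assumes g: "\<And>t. t > 0 \<Longrightarrow> g t = 1 / sqrt (\<nu> (1 / t))" "index_function g"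
  shows "in_scale_space f inv_op \<nu> \<longleftrightarrow> (\<exists>v. (v, f) \<in> fun_of_op g (graph_of B))"
proof -
  have "zero_extension g \<in> borel_measurable borel"
    using borel_measurable_index_function[OF g(2)] by (simp add: zero_extension_def)
  \<comment> \<open>For \<open>t \<le> 0\<close> both sides are 0, the right one through
    \<open>1 / sqrt 0 = 0\<close>.\<close>
  moreover have "(\<lambda>t. zero_extension g (inverse t)) = \<kappa>"
    by (auto simp: fun_eq_iff zero_extension_def g(1) inverse_eq_divide)
  ultimately have "fun_of_op g (graph_of B) = spectral_integral E \<kappa>"
    using fun_of_op_graph[OF E] by metis
  then show ?thesis by (simp only: in_scale_space_iff \<rho>_iff_\<kappa>)
qed

end

section \<open>The operator \<open>A\<^sup>* A\<close> and the source condition\<close>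

theorem proposition2p9:
  fixes A :: "'a::{real_inner, complete_space} \<Rightarrow> 'b::{real_inner, complete_space}"
    and T :: "'a operator"
    and \<Psi> \<phi> \<theta> \<psi> \<psi>bar :: "real \<Rightarrow> real"
  assumes "infinite_dimensional TYPE('a)" and "infinite_dimensional TYPE('b)"
    and "separable_space (euclidean :: 'a topology)" and "separable_space (euclidean :: 'b topology)"
    and "bounded_linear A" and "inj A" and "\<not> closed (range A)"
    and "index_function \<Psi>" and "concave_on {0<..} \<Psi>" and "strict_mono_on {0<..} \<Psi>"
    and "(\<Psi> \<longlongrightarrow> 0) (at_right 0)" and "filterlim \<Psi> at_top at_top"
    and "((\<lambda>l. \<Psi> l / l) \<longlongrightarrow> 0) at_top"
    and T: "T = (graph_of (adjoint A \<circ> A))\<inverse>"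
    and \<phi>: "\<And>l. l > 0 \<Longrightarrow> \<phi> l = l"
    and \<theta>: "\<And>l. l > 0 \<Longrightarrow> \<theta> l = 1 / l"
    and \<psi>: "\<And>l. l > 0 \<Longrightarrow> \<psi> l = the_inv_into {0<..} \<Psi> l"
    and \<psi>bar: "\<And>t. t > 0 \<Longrightarrow> \<psi>bar t = 1 / sqrt (t * the_inv_into {0<..} \<Psi> (1 / t))"
  shows "(\<forall>F\<in>scale_space T (\<lambda>l. \<psi> l * \<theta> l). \<exists>!f. represents F f) \<and>
    (\<forall>f. in_scale_space f T (\<lambda>l. \<psi> l * \<theta> l) \<longleftrightarrow>
      (\<exists>v. (v, f) \<in> fun_of_op \<psi>bar (graph_of (adjoint A \<circ> A)))) \<and>
    rate_function \<psi>bar"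
proof -
  let ?B = "adjoint A \<circ> A"
  define \<nu> where "\<nu> = (\<lambda>l. \<psi> l * \<theta> l)"
  interpret A: bounded_linear A by fact
  obtain k where k: "0 < k" "\<And>x. norm (A x) \<le> norm x * k" using A.pos_bounded by blast
  have inner_B: "inner (?B x) y = inner (A x) (A y)" for x y
    using inner_adjoint[OF \<open>bounded_linear A\<close>, of y "A x"] by (simp add: inner_commute)
  have B_bound: "norm (?B x) \<le> k\<^sup>2 * norm x" for x
  proof -
    \<comment> \<open>The bound \<open>\<parallel>A\<parallel>\<^sup>2\<close> for
      \<open>A\<^sup>* A\<close>, obtained from Cauchy-Schwarz after division by
      \<open>norm (?B x)\<close>.\<close>
    have "norm (?B x) * norm (?B x) = inner (A x) (A (?B x))"
      using inner_B[of x "?B x"] by (simp only: power2_norm_eq_inner[symmetric] power2_eq_square)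
    also have "\<dots> \<le> norm (A x) * norm (A (?B x))" by (rule norm_cauchy_schwarz)
    also have "\<dots> \<le> (norm x * k) * (norm (?B x) * k)"
      using k by (intro mult_mono) auto
    finally have "norm (?B x) * norm (?B x) \<le> (k\<^sup>2 * norm x) * norm (?B x)"
      by (simp only: power2_eq_square mult_ac)
    then show ?thesis by (cases "norm (?B x) = 0") (use k in \<open>auto simp: mult_le_cancel_right\<close>)
  qed
  interpret B: positive_injective_operator ?B "k\<^sup>2"
  proof
    show "0 < k\<^sup>2" using k by simp
    show "norm (?B x) \<le> k\<^sup>2 * norm x" for x by (rule B_bound)
    show "0 \<le> inner (?B x) x" for x unfolding inner_B by simp
    show "x = 0" if "?B x = 0" for x
    proof -
      have "inner (A x) (A x) = 0" using inner_B[of x x] that by simp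
      then show ?thesis using \<open>inj A\<close> A.zero by (metis inner_eq_zero_iff injD)
    qed
  qed
  \<comment> \<open>\<open>\<psi>\<close> and \<open>\<theta>\<close> are prescribed on
    \<open>(0, \<infinity>)\<close> only, so the properties of the inverse ratio are transferred to
    \<open>\<nu>\<close> through agreement there.\<close>
  have \<nu>_eq: "\<nu> l = the_inv_into {0<..} \<Psi> l / l" if "0 < l" for l
    using that by (simp add: \<nu>_def \<psi> \<theta>)
  note inv = assms(8-13)
  have index: "index_function \<nu>"
  proof -
    have "continuous_on {0<..} \<nu>"
      using index_function_inverse_ratio[OF inv] \<nu>_eq
      by (auto simp: index_function_def intro: continuous_on_eq)
    then show ?thesis using index_function_inverse_ratio[OF inv] by (simp add: index_function_def \<nu>_eq)
  qed
  have mono: "mono_on {0<..} \<nu>"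
    using mono_inverse_ratio[OF inv] by (simp add: mono_on_def \<nu>_eq)
  have top: "filterlim \<nu> at_top at_top"
  proof (rule filterlim_mono_eventually[OF inverse_ratio_at_top[OF inv] order_refl order_refl])
    show "eventually (\<lambda>l. the_inv_into {0<..} \<Psi> l / l = \<nu> l) at_top"
      using eventually_gt_at_top[of 0] by eventually_elim (simp add: \<nu>_eq)
  qed
  have \<psi>bar_eq: "\<psi>bar t = 1 / sqrt (\<nu> (1 / t))" if "0 < t" for t
    using that by (simp add: \<psi>bar \<nu>_eq mult.commute)
  have rate: "rate_function \<psi>bar"
    by (rule rate_function_inverse_sqrt[OF index mono top \<psi>bar_eq])
  have "(\<forall>F\<in>scale_space T \<nu>. \<exists>!f. represents F f) \<and>
    (\<forall>f. in_scale_space f T \<nu> \<longleftrightarrow> (\<exists>v. (v, f) \<in> fun_of_op \<psi>bar (graph_of ?B)))"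
  proof (cases "\<exists>E. spectral_measure_of T E")
    case True
    then obtain E where E: "spectral_measure_of T E" ..
    interpret variable_scale ?B "k\<^sup>2" E \<nu>
      using E index mono pvm_spectral_measure[OF E]
      by (intro variable_scale.intro B.positive_injective_operator_axioms) (auto intro: variable_scale_axioms.intro simp: T)
    show ?thesis
      unfolding T
      using represents_unique in_scale_space_iff_source[OF \<psi>bar_eq] rate
      by (auto simp: rate_function_def)
  next
    case False
    \<comment> \<open>Without a spectral measure of \<open>T\<close>, the relation
      \<open>fun_of_op \<nu> T\<close> is empty, so no sequence has its terms in the domain and
      there are no classes.\<close>
    then have "scale_space T \<nu> = {}"
      by (auto simp: scale_space_def scale_Cauchy_def fun_of_op_def)
    moreover have "fun_of_op \<psi>bar (graph_of ?B) = {}"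
      using False B.spectral_measure_inv_op by (auto simp: fun_of_op_def T)
    ultimately show ?thesis by (simp add: in_scale_space_def)
  qed
  then show ?thesis using rate unfolding \<nu>_def by blast
qed

end
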